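(* Let $0<q<1$ and let $\widetilde a,\widetilde b,\widetilde c$ be real with $0<q\widetilde a<1$, $0<q\widetilde b<1$, $\widetilde c<0$. For each integer $N\ge1$ choose $\alpha,\beta\in\mathbb R$, $a,b\in\mathbb C$ with $q^\alpha=\widetilde a$, $q^\beta=\widetilde b$, $b-a=N+1$, $q^{a+b}=\widetilde c/\widetilde a$, and put $$C_n=(q^{N})^{n/2}(q\widetilde a)^n\Big(\frac{\widetilde c}{\widetilde a}\Big)^{n/2}\kappa_q^{2n},\qquad \Big(\frac{\widetilde c}{\widetilde a}\Big)^{1/2}:=q^{(a+b)/2}.$$ Let $\beta_n,\gamma_n$ be the coefficients of the three-term recurrence relation $\mu(s)u_n^{\alpha,\beta}(s)_q=u_{n+1}^{\alpha,\beta}(s)_q+\beta_nu_n^{\alpha,\beta}(s)_q+\gamma_nu_{n-1}^{\alpha,\beta}(s)_q$ of the non-standard $q$-Racah polynomials. Then, with $\widetilde\mu(s)=q^{N+1}\widetilde a q^{a+1}\frac{\mu(s+a)-c_3}{c_1}$, the recurrence relation (multiplied by $C_n$ and rewritten as) $$\widetilde\mu(s)\,C_nu_n^{\alpha,\beta}(s+a)_q=q^{N+1}\widetilde a\frac{q^{a+1}}{c_1}C_nu_{n+1}^{\alpha,\beta}(s+a)_q+q^{N+1}\widetilde a\frac{q^{a+1}}{c_1}[\beta_n-c_3]C_nu_n^{\alpha,\beta}(s+a)_q+q^{N+1}\widetilde a\frac{q^{a+1}}{c_1}\gamma_nC_nu_{n-1}^{\alpha,\beta}(s+a)_q$$ transforms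 as $N\to\infty$ into the three-term recurrence relation $$zP_n(z)=P_{n+1}(z)+\widetilde\beta_nP_n(z)+\widetilde\gamma_nP_{n-1}(z)$$ of the monic big $q$-Jacobi polynomials $P_n(z)=P_n(z;\widetilde a,\widetilde b,\widetilde c;q)$, at the points $z\in\{q^{s+1}\widetilde c\}_{s\ge0}\cup\{q^{s+1}\widetilde a\}_{s\ge0}$; namely, for every fixed $n\ge0$ ($n\ge1$ for the second limit), $$\lim_{N\to\infty}q^{N+1}\widetilde a\frac{q^{a+1}}{c_1}[\beta_n-c_3]=\widetilde\beta_n,\qquad \lim_{N\to\infty}q^{N+1}\widetilde a\frac{q^{a+1}}{c_1}\frac{C_n}{C_{n-1}}\gamma_n=\widetilde\gamma_n,$$ where $$\widetilde\beta_n=1-\frac{(1-\widetilde aq^{n+1})(1-\widetilde a\widetilde bq^{n+1})(1-\widetilde cq^{n+1})}{(1-\widetilde a\widetilde bq^{2n+1})(1-\widetilde a\widetilde bq^{2n+2})}+\widetilde a\widetilde cq^{n+1}\frac{(1-q^n)(1-\widetilde a\widetilde b\widetilde c^{-1}q^n)(1-\widetilde bq^n)}{(1-\widetilde a\widetilde bq^{2n})(1-\widetilde a\widetilde bq^{2n+1})}$$ $$=q\widetilde c+\widetilde aq^{n+1}\frac{(1-\widetilde a\widetilde bq^{n+1})(1-\widetilde bq^{n+1})(1-\widetilde cq^{n+1})}{(1-\widetilde a\widetilde bq^{2n+1})(1-\widetilde a\widetilde bq^{2n+2})}-q\widetilde c\frac{(1-\widetilde aq^n)(1-\widetilde a\widetilde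 b\widetilde c^{-1}q^n)(1-q^n)}{(1-\widetilde a\widetilde bq^{2n})(1-\widetilde a\widetilde bq^{2n+1})},$$ $$\widetilde\gamma_n=-\widetilde a\widetilde cq^{n+1}\frac{(1-q^n)(1-\widetilde aq^n)(1-\widetilde bq^n)(1-\widetilde cq^n)(1-\widetilde a\widetilde bq^n)(1-\widetilde a\widetilde b\widetilde c^{-1}q^n)}{(1-\widetilde a\widetilde bq^{2n-1})(1-\widetilde a\widetilde bq^{2n})^2(1-\widetilde a\widetilde bq^{2n+1})}.$$
   Context: Notation. $0<q<1$, $q^z=e^{z\log q}$. $(x;q)_k=\prod_{i=0}^{k-1}(1-xq^i)$, $(x_1,\dots,x_r;q)_k=\prod_j(x_j;q)_k$; ${}_r\varphi_{r-1}$ is the standard basic hypergeometric series. $\kappa_q=q^{1/2}-q^{-1/2}$; $[s]_q=\dfrac{q^{s/2}-q^{-s/2}}{q^{1/2}-q^{-1/2}}$, $s\in\mathbb C$. Lattice: $\mu(s)=[s]_q[s+1]_q=c_1(q^s+q^{-s-1})+c_3$ with $c_1=q^{1/2}\kappa_q^{-2}$, $c_3=-q^{-1/2}(1+q)\kappa_q^{-2}$. Non-standard monic $q$-Racah polynomials: $$u_n^{\alpha,\beta}(s)_q=q^{-\frac n2(2a+1)}\frac{(q^{a-b+1},q^{\beta+1},q^{a+b+\alpha+1};q)_n}{\kappa_q^{2n}(q^{\alpha+\beta+n+1};q)_n}\;{}_4\varphi_3\!\left(\begin{matrix}q^{-n},q^{\alpha+\beta+n+1},q^{a-s},q^{a+s+1}\\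 q^{a-b+1},q^{\beta+1},q^{a+b+\alpha+1}\end{matrix}\Big|\,q,q\right),$$ with recurrence coefficients $$\beta_n=[a]_q[a+1]_q-\frac{[\alpha+\beta+n+1]_q[a-b+n+1]_q[\beta+n+1]_q[a+b+\alpha+n+1]_q}{[\alpha+\beta+2n+1]_q[\alpha+\beta+2n+2]_q}-\frac{[\alpha+n]_q[b-a+\alpha+\beta+n]_q[-a-b+\beta+n]_q[n]_q}{[\alpha+\beta+2n]_q[\alpha+\beta+2n+1]_q},$$ $$\gamma_n=\frac{[n]_q[\alpha+\beta+n]_q[\alpha+n]_q[\beta+n]_q[b-a+\alpha+\beta+n]_q[-a-b+\beta+n]_q[a-b+n]_q[a+b+\alpha+n]_q}{[\alpha+\beta+2n-1]_q([\alpha+\beta+2n]_q)^2[\alpha+\beta+2n+1]_q}.$$ Monic big $q$-Jacobi polynomials: $$P_n(z;\widetilde a,\widetilde b,\widetilde c;q)=(-\widetilde a)^nq^{\frac{n(n+1)}2}\frac{(q\widetilde b,q\widetilde c;q)_n}{(\widetilde a\widetilde bq^{n+1};q)_n}\;{}_3\varphi_2\!\left(\begin{matrix}q^{-n},\widetilde a\widetilde bq^{n+1},q\widetilde cz^{-1}\\ q\widetilde b,q\widetilde c\end{matrix}\Big|\,q,\frac z{\widetilde a}\right).$$ Conventions: common factors in the recurrence coefficients are cancelled before evaluation; terms containing $[n]_q$ or $1-q^n$ vanish for $n=0$; $u_{-1}=P_{-1}=0$. *)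

theory Defs
  imports "HOL-Analysis.Analysis"
begin

definition qpoch :: "'a::comm_ring_1 \<Rightarrow> 'a \<Rightarrow> nat \<Rightarrow> 'a" where
  "qpoch x q k = (\<Prod>i<k. 1 - x * q ^ i)"

definition qpochs :: "'a::comm_ring_1 list \<Rightarrow> 'a \<Rightarrow> nat \<Rightarrow> 'a" where
  "qpochs xs q k = (\<Prod>x\<leftarrow>xs. qpoch x q k)"

(* The series r phi (r-1), so length xs = Suc (length ys) in every use. If some
   numerator parameter is q^(-n), the terms with k > n are 0, also where a denominator
   parameter q^(-N) with N >= n makes the denominator vanish (since 0 / 0 = 0). *)
definition basic_hyp :: "'a::real_normed_field list \<Rightarrow> 'a list \<Rightarrow> 'a \<Rightarrow> 'a \<Rightarrow> 'a" where
  "basic_hyp xs ys q z = (\<Sum>k. qpochs xs q k / (qpochs ys q k * qpoch q q k) * z ^ k)"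

abbreviation qpow :: "real \<Rightarrow> complex \<Rightarrow> complex" where
  "qpow q z \<equiv> complex_of_real q powr z"

definition kappa :: "real \<Rightarrow> complex" where
  "kappa q = qpow q (1/2) - qpow q (- 1/2)"

definition qnum :: "real \<Rightarrow> complex \<Rightarrow> complex" where
  "qnum q s = (qpow q (s/2) - qpow q (- s/2)) / (qpow q (1/2) - qpow q (- 1/2))"

definition lattice_mu :: "real \<Rightarrow> complex \<Rightarrow> complex" where
  "lattice_mu q s = qnum q s * qnum q (s + 1)"

definition lattice_c1 :: "real \<Rightarrow> complex" where
  "lattice_c1 q = qpow q (1/2) / kappa q ^ 2"

definition lattice_c3 :: "real \<Rightarrow> complex" where
  "lattice_c3 q = - qpow q (- 1/2) * (1 + of_real q) / kappa q ^ 2"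

definition qRacah ::
  "real \<Rightarrow> complex \<Rightarrow> complex \<Rightarrow> complex \<Rightarrow> complex \<Rightarrow> nat \<Rightarrow> complex \<Rightarrow> complex" where
  "qRacah q \<alpha> \<beta> a b n s =
     qpow q (- (of_nat n / 2) * (2 * a + 1))
     * (qpochs [qpow q (a - b + 1), qpow q (\<beta> + 1), qpow q (a + b + \<alpha> + 1)] (of_real q) n
        / (kappa q ^ (2 * n) * qpoch (qpow q (\<alpha> + \<beta> + of_nat n + 1)) (of_real q) n))
     * basic_hyp
         [qpow q (- of_nat n), qpow q (\<alpha> + \<beta> + of_nat n + 1), qpow q (a - s), qpow q (a + s + 1)]
         [qpow q (a - b + 1), qpow q (\<beta> + 1), qpow q (a + b + \<alpha> + 1)]
         (of_real q) (of_real q)"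

(* Conventions for the recurrence coefficients, here and for big q-Jacobi: for q^(alpha+1),
   q^(beta+1) in (0,1) the only denominators that can vanish are alpha+beta+2n+1 and
   alpha+beta+2n at n = 0, and alpha+beta+2n-1 at n = 1 and n = 0. The first at n = 0
   and the third at n = 1 cancel against a numerator factor, hence the case distinctions;
   the other cases only occur in terms that carry [n] or 1 - q^n and so are 0. *)

definition qRacah_beta ::
  "real \<Rightarrow> complex \<Rightarrow> complex \<Rightarrow> complex \<Rightarrow> complex \<Rightarrow> nat \<Rightarrow> complex" where
  "qRacah_beta q \<alpha> \<beta> a b n =
     (let m = of_nat n in
      qnum q a * qnum q (a + 1)
      - (if n = 0 then 1 else qnum q (\<alpha> + \<beta> + m + 1) / qnum q (\<alpha> + \<beta> + 2 * m + 1))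
        * (qnum q (a - b + m + 1) * qnum q (\<beta> + m + 1) * qnum q (a + b + \<alpha> + m + 1)
           / qnum q (\<alpha> + \<beta> + 2 * m + 2))
      - qnum q (\<alpha> + m) * qnum q (b - a + \<alpha> + \<beta> + m) * qnum q (- a - b + \<beta> + m) * qnum q m
        / (qnum q (\<alpha> + \<beta> + 2 * m) * qnum q (\<alpha> + \<beta> + 2 * m + 1)))"

definition qRacah_gamma ::
  "real \<Rightarrow> complex \<Rightarrow> complex \<Rightarrow> complex \<Rightarrow> complex \<Rightarrow> nat \<Rightarrow> complex" where
  "qRacah_gamma q \<alpha> \<beta> a b n =
     (let m = of_nat n in
      (if n = 1 then 1 else qnum q (\<alpha> + \<beta> + m) / qnum q (\<alpha> + \<beta> + 2 * m - 1))
      * (qnum q m * qnum q (\<alpha> + m) * qnum q (\<beta> + m)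
         * qnum q (b - a + \<alpha> + \<beta> + m) * qnum q (- a - b + \<beta> + m)
         * qnum q (a - b + m) * qnum q (a + b + \<alpha> + m)
         / (qnum q (\<alpha> + \<beta> + 2 * m) ^ 2 * qnum q (\<alpha> + \<beta> + 2 * m + 1))))"

definition bigqJacobi :: "nat \<Rightarrow> real \<Rightarrow> real \<Rightarrow> real \<Rightarrow> real \<Rightarrow> real \<Rightarrow> real" where
  "bigqJacobi n z a b c q =
     (- a) ^ n * q ^ (n * (n + 1) div 2)
     * (qpochs [q * b, q * c] q n / qpoch (a * b * q ^ (n + 1)) q n)
     * basic_hyp [inverse q ^ n, a * b * q ^ (n + 1), q * c * inverse z] [q * b, q * c] q (z / a)"

definition bigqJacobi_beta :: "real \<Rightarrow> real \<Rightarrow> real \<Rightarrow> real \<Rightarrow> nat \<Rightarrow> real" where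
  "bigqJacobi_beta q a b c n =
     1 - (if n = 0 then 1 else (1 - a*b*q^(n+1)) / (1 - a*b*q^(2*n+1)))
         * ((1 - a*q^(n+1)) * (1 - c*q^(n+1)) / (1 - a*b*q^(2*n+2)))
     + a*c*q^(n+1) * ((1 - q^n) * (1 - a*b*inverse c*q^n) * (1 - b*q^n)
         / ((1 - a*b*q^(2*n)) * (1 - a*b*q^(2*n+1))))"

definition bigqJacobi_beta_alt :: "real \<Rightarrow> real \<Rightarrow> real \<Rightarrow> real \<Rightarrow> nat \<Rightarrow> real" where
  "bigqJacobi_beta_alt q a b c n =
     q*c + a*q^(n+1) * (if n = 0 then 1 else (1 - a*b*q^(n+1)) / (1 - a*b*q^(2*n+1)))
         * ((1 - b*q^(n+1)) * (1 - c*q^(n+1)) / (1 - a*b*q^(2*n+2)))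
     - q*c * ((1 - a*q^n) * (1 - a*b*inverse c*q^n) * (1 - q^n)
         / ((1 - a*b*q^(2*n)) * (1 - a*b*q^(2*n+1))))"

definition bigqJacobi_gamma :: "real \<Rightarrow> real \<Rightarrow> real \<Rightarrow> real \<Rightarrow> nat \<Rightarrow> real" where
  "bigqJacobi_gamma q a b c n =
     - a*c*q^(n+1) * (if n = 1 then 1 else (1 - a*b*q^n) / (1 - a*b*q^(2*n-1)))
       * ((1 - q^n) * (1 - a*q^n) * (1 - b*q^n) * (1 - c*q^n) * (1 - a*b*inverse c*q^n)
          / ((1 - a*b*q^(2*n))^2 * (1 - a*b*q^(2*n+1))))"

(* C_n; ta is a-tilde, and the square root of c-tilde / a-tilde is the branch q^((a+b)/2). *)
definition scaling_C :: "real \<Rightarrow> real \<Rightarrow> nat \<Rightarrow> complex \<Rightarrow> complex \<Rightarrow> nat \<Rightarrow> complex" where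
  "scaling_C q ta N a b n =
     of_real ((q ^ N) powr (real n / 2)) * of_real ((q * ta) ^ n)
     * qpow q ((a + b) / 2) ^ n * kappa q ^ (2 * n)"

(* the common factor of all coefficients on the right of the rewritten recurrence *)
definition scaling_K :: "real \<Rightarrow> real \<Rightarrow> nat \<Rightarrow> complex \<Rightarrow> complex" where
  "scaling_K q ta N a = of_real (q ^ (N + 1) * ta) * (qpow q (a + 1) / lattice_c1 q)"

definition mu_tilde :: "real \<Rightarrow> real \<Rightarrow> nat \<Rightarrow> complex \<Rightarrow> complex \<Rightarrow> complex" where
  "mu_tilde q ta N a s =
     of_real (q ^ (N + 1) * ta) * qpow q (a + 1)
     * ((lattice_mu q (s + a) - lattice_c3 q) / lattice_c1 q)"

end

theory Submission
  imports Defs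
begin

text \<open>
  Put \<open>E = q\<^sup>a\<^sup>-\<^sup>s\<close> and \<open>F = q\<^sup>a\<^sup>+\<^sup>s\<^sup>+\<^sup>1\<close>, so that \<open>E F = q\<^sup>2\<^sup>a\<^sup>+\<^sup>1\<close> does not depend on \<open>s\<close> and
  \<open>\<mu>(s)\<close> is an affine function of \<open>(1 - E)(1 - F)\<close>. Multiplication by \<open>(1 - E)(1 - F)\<close> maps
  \<open>(E, F; q)\<^sub>k\<close> to a combination of \<open>(E, F; q)\<^sub>k\<close> and \<open>(E, F; q)\<close> with index \<open>k + 1\<close>, so the
  recurrence relation follows by comparing coefficients, which comes down to one polynomial identity
  in \<open>q\<^sup>k\<close> and \<open>q\<^sup>n\<close>.

  The hypothesis \<open>b - a = N + 1\<close> makes \<open>C\<^sub>n\<close> the \<open>n\<close>-th power of the factor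
  \<open>q\<^sup>N\<^sup>+\<^sup>1 ta q\<^sup>a\<^sup>+\<^sup>1 / c\<^sub>1\<close>, and all rescaled quantities become real rational functions of
  \<open>d = q\<^sup>N\<close>. At both families of points \<open>{E, F} = {e, w / d}\<close> with fixed \<open>e w = tc / ta\<close>, and the
  limits are those for \<open>d \<rightarrow> 0\<close>, with \<open>z = q ta w\<close>. The recurrence relation of the big
  \<open>q\<close>-Jacobi polynomials is then the limit of the rescaled one.
\<close>

section \<open>The recurrence relation of a terminating balanced series\<close>

lemma qpoch_Suc: "qpoch x q (Suc k) = qpoch x q k * (1 - x * q ^ k)"
  by (simp add: qpoch_def)

lemma qpoch_Suc_left: "qpoch x q (Suc k) = (1 - x) * qpoch (x * q) q k"
  unfolding qpoch_def prod.lessThan_Suc_shift by (simp add: mult_ac)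

lemma qpoch_0 [simp]: "qpoch x q 0 = 1"
  by (simp add: qpoch_def)

lemma qpoch_eq_0_iff:
  fixes x :: "'a::idom"
  shows "qpoch x q k = 0 \<longleftrightarrow> (\<exists>i<k. x * q ^ i = 1)"
  by (auto simp: qpoch_def)

lemma qpoch_inverse_power_eq_0:
  fixes q :: "'a::field"
  assumes "q \<noteq> 0" "n < k"
  shows "qpoch (inverse q ^ n) q k = 0"
  using assms by (auto simp: qpoch_eq_0_iff power_inverse intro!: exI[of _ n])

text \<open>The coefficient of (E, F; q)_k in a terminating 4phi3 at argument q with denominator
  parameters \<open>A1\<close>, \<open>A2\<close>, \<open>A3\<close>; later \<rho> stands for
  q^(\<alpha>+\<beta>+1). The field is arbitrary because the recurrence is used over the complex
  numbers and the limits are taken over the reals.\<close>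

definition racah_coeff :: "'a::field \<Rightarrow> 'a \<Rightarrow> 'a \<Rightarrow> 'a \<Rightarrow> 'a \<Rightarrow> nat \<Rightarrow> nat \<Rightarrow> 'a" where
  "racah_coeff q \<rho> A1 A2 A3 n k =
     qpoch (inverse q ^ n) q k * qpoch (\<rho> * q ^ n) q k
     / (qpoch A1 q k * qpoch A2 q k * qpoch A3 q k * qpoch q q k) * q ^ k"

definition racah_sum ::
  "'a::field \<Rightarrow> 'a \<Rightarrow> 'a \<Rightarrow> 'a \<Rightarrow> 'a \<Rightarrow> 'a \<Rightarrow> 'a \<Rightarrow> nat \<Rightarrow> 'a" where
  "racah_sum q \<rho> A1 A2 A3 E F n =
     (\<Sum>k\<le>n. racah_coeff q \<rho> A1 A2 A3 n k * (qpoch E q k * qpoch F q k))"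

text \<open>
  For \<open>n = 0\<close> the factor \<open>1 - \<rho>\<close>, which may be \<open>0\<close>, is cancelled in \<open>racah_A\<close>, and the truncated
  subtraction \<open>2 * n - 1\<close> in \<open>racah_C\<close> is harmless because of the factor \<open>1 - q ^ n\<close>.
\<close>

definition racah_A :: "'a::field \<Rightarrow> 'a \<Rightarrow> 'a \<Rightarrow> 'a \<Rightarrow> 'a \<Rightarrow> nat \<Rightarrow> 'a" where
  "racah_A q \<rho> A1 A2 A3 n =
     (if n = 0 then 1 else (1 - \<rho> * q ^ n) / (1 - \<rho> * q ^ (2 * n)))
     * ((1 - A1 * q ^ n) * (1 - A2 * q ^ n) * (1 - A3 * q ^ n) / (1 - \<rho> * q ^ (2 * n + 1)))"

definition racah_C :: "'a::field \<Rightarrow> 'a \<Rightarrow> 'a \<Rightarrow> 'a \<Rightarrow> 'a \<Rightarrow> 'a \<Rightarrow> nat \<Rightarrow> 'a" where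
  "racah_C q \<rho> G A1 A2 A3 n =
     G * (1 - q ^ n) * (1 - \<rho> / A1 * q ^ n) * (1 - \<rho> / A2 * q ^ n) * (1 - \<rho> / A3 * q ^ n)
     / ((1 - \<rho> * q ^ (2 * n - 1)) * (1 - \<rho> * q ^ (2 * n)))"

lemma racah_coeff_0 [simp]: "racah_coeff q \<rho> A1 A2 A3 n 0 = 1"
  by (simp add: racah_coeff_def)

lemma racah_coeff_eq_0: "q \<noteq> 0 \<Longrightarrow> n < k \<Longrightarrow> racah_coeff q \<rho> A1 A2 A3 n k = 0"
  by (simp add: racah_coeff_def qpoch_inverse_power_eq_0)

text \<open>Lets the sums for n - 1, n and n + 1 be written over one range, so that coefficients can
  be compared.\<close>

lemma racah_sum_extend:
  assumes "q \<noteq> 0" "n \<le> m"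
  shows "racah_sum q \<rho> A1 A2 A3 E F n =
     (\<Sum>k\<le>m. racah_coeff q \<rho> A1 A2 A3 n k * (qpoch E q k * qpoch F q k))"
  unfolding racah_sum_def
  by (rule sum.mono_neutral_left) (use assms in \<open>auto simp: racah_coeff_eq_0\<close>)

text \<open>Passing from n to n + 1 shifts q^(-n) and \<rho> q^n in opposite directions, so both
  coefficients share the factors (q^(-n); q)_j and (\<rho> q^(n+1); q)_j. What is left is a
  difference of two products of two factors, and it collapses to a single product.\<close>

lemma racah_coeff_diff:
  fixes q :: "'a::field"
  assumes "q \<noteq> 0"
  shows "racah_coeff q \<rho> A1 A2 A3 (Suc n) (Suc j) - racah_coeff q \<rho> A1 A2 A3 n (Suc j) =
    - (1 - q ^ Suc j) * (1 - \<rho> * q ^ (2 * n + 1)) / q ^ Suc n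
    * (qpoch (inverse q ^ n) q j * qpoch (\<rho> * q ^ Suc n) q j)
    / (qpoch A1 q (Suc j) * qpoch A2 q (Suc j) * qpoch A3 q (Suc j) * qpoch q q (Suc j)) * q ^ Suc j"
    (is "_ = ?c * (?x * ?y) / ?D * _")
proof -
  have "inverse q ^ Suc n * q = inverse q ^ n"
    using assms by simp
  then have 1: "qpoch (inverse q ^ Suc n) q (Suc j) = (1 - inverse q ^ Suc n) * ?x"
    by (simp only: qpoch_Suc_left)
  have 2: "qpoch (\<rho> * q ^ Suc n) q (Suc j) = ?y * (1 - \<rho> * q ^ Suc n * q ^ j)"
    by (rule qpoch_Suc)
  have 3: "qpoch (inverse q ^ n) q (Suc j) = ?x * (1 - inverse q ^ n * q ^ j)"
    by (rule qpoch_Suc)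
  have 4: "qpoch (\<rho> * q ^ n) q (Suc j) = (1 - \<rho> * q ^ n) * ?y"
    by (simp only: qpoch_Suc_left power_Suc2 mult.assoc)
  have 5: "(1 - inverse q ^ Suc n) * (1 - \<rho> * q ^ Suc n * q ^ j)
      - (1 - inverse q ^ n * q ^ j) * (1 - \<rho> * q ^ n) = ?c"
    using assms by (simp add: field_simps power_add mult_2 mult_2_right)
  show ?thesis
    unfolding racah_coeff_def 1 2 3 4 5[symmetric]
    by (simp add: diff_divide_distrib[symmetric] left_diff_distrib[symmetric]) (simp add: algebra_simps)
qed

text \<open>Both sides are x times a polynomial of degree at most 1 in x: on the left the constant
  terms cancel, and by the balancing condition \<open>G\<close> so do the cubic ones. Such a
  polynomial is determined by its values at the two zeros x = y and x = 1 / (\<rho> y) of (1 - x /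
  y) (1 - \<rho> y x), which are distinct because 1 - \<rho> y^2 is not 0. The proof eliminates
  \<open>G\<close> and expands.\<close>

lemma racah_interpolation:
  fixes q :: "'a::field"
  assumes nz: "q \<noteq> 0" "y \<noteq> 0" "\<rho> \<noteq> 0" "A1 \<noteq> 0" "A2 \<noteq> 0" "A3 \<noteq> 0" "1 - \<rho> * y\<^sup>2 \<noteq> 0"
    and G: "q * \<rho> * G = A1 * A2 * A3"
  shows "((1 - G * q * x) * (1 - x / y) * (1 - \<rho> * y * x)
           - (1 - A1 * x) * (1 - A2 * x) * (1 - A3 * x)) * (1 - \<rho> * y\<^sup>2)
    = - (x * (1 - A1 * y) * (1 - A2 * y) * (1 - A3 * y) * (1 - \<rho> * y * x) / y)
      - q * x * G * (1 - \<rho> / A1 * y) * (1 - \<rho> / A2 * y) * (1 - \<rho> / A3 * y) * (1 - x / y)"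
proof -
  have G': "G = A1 * A2 * A3 / (q * \<rho>)"
    using G nz by (simp add: field_simps)
  show ?thesis
    unfolding G' using nz by (simp add: divide_simps) (simp add: algebra_simps power2_eq_square)
qed

text \<open>The comparison of the coefficients of (E, F; q)_(j+1) for n = m + 1; writing
  \<open>Suc m\<close> makes n - 1 equal to \<open>m\<close> without truncation. All terms are
  multiples of the common term \<open>T\<close>, and their cofactors are related by
  \<open>racah_interpolation\<close> at x = q^j and y = q^(m+1).\<close>

lemma racah_coeff_recurrence:
  fixes q :: "'a::field"
  assumes nz: "q \<noteq> 0" "\<rho> \<noteq> 0" "A1 \<noteq> 0" "A2 \<noteq> 0" "A3 \<noteq> 0"
    and G: "q * \<rho> * G = A1 * A2 * A3"
    and den: "A1 * q ^ j \<noteq> 1" "A2 * q ^ j \<noteq> 1" "A3 * q ^ j \<noteq> 1" "q ^ Suc j \<noteq> 1"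
    and \<rho>: "\<rho> * q ^ (2 * m + 1) \<noteq> 1" "\<rho> * q ^ (2 * m + 2) \<noteq> 1" "\<rho> * q ^ (2 * m + 3) \<noteq> 1"
  defines "r \<equiv> racah_coeff q \<rho> A1 A2 A3"
  shows "- (1 - 1 / q ^ Suc j) * (1 - G * q ^ Suc j) * r (Suc m) (Suc j) - r (Suc m) j / q ^ j
    = racah_A q \<rho> A1 A2 A3 (Suc m) * (r (Suc (Suc m)) (Suc j) - r (Suc m) (Suc j))
      + racah_C q \<rho> G A1 A2 A3 (Suc m) * (r m (Suc j) - r (Suc m) (Suc j))"
proof -
  define x y where "x = q ^ j" and "y = q ^ Suc m"
  define X Z where "X = qpoch (inverse q ^ Suc m) q j" and "Z = qpoch (\<rho> * y) q j"
  define X' Z' where "X' = qpoch (inverse q ^ m) q j" and "Z' = qpoch (\<rho> * (q * y)) q j"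
  define D P where "D = qpoch A1 q j * qpoch A2 q j * qpoch A3 q j * qpoch q q j"
    and "P = (1 - A1 * x) * (1 - A2 * x) * (1 - A3 * x)"
  define T where "T = X * Z / D * x"
  define S S' where "S = (1 - A1 * y) * (1 - A2 * y) * (1 - A3 * y)"
    and "S' = G * (1 - \<rho> / A1 * y) * (1 - \<rho> / A2 * y) * (1 - \<rho> / A3 * y)"
  have xy: "x \<noteq> 0" "y \<noteq> 0" using nz by (auto simp: x_def y_def)
  have P: "P \<noteq> 0" and qx: "1 - q * x \<noteq> 0"
    using den by (auto simp: P_def x_def)
  have e: "\<rho> * q ^ (2 * m + 1) = \<rho> * y\<^sup>2 / q" "\<rho> * q ^ (2 * m + 2) = \<rho> * y\<^sup>2"
    "\<rho> * q ^ (2 * m + 3) = \<rho> * y\<^sup>2 * q"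
    using nz by (auto simp: y_def power_add power2_eq_square mult_2 eval_nat_numeral)
  have \<rho>': "1 - \<rho> * y\<^sup>2 / q \<noteq> 0" "1 - \<rho> * y\<^sup>2 \<noteq> 0" "1 - \<rho> * y\<^sup>2 * q \<noteq> 0"
    using \<rho> unfolding e by auto
  have DS: "qpoch A1 q (Suc j) * qpoch A2 q (Suc j) * qpoch A3 q (Suc j) * qpoch q q (Suc j)
      = D * (P * (1 - q * x))"
    by (simp add: qpoch_Suc D_def P_def x_def mult_ac)
  have iy: "inverse q ^ Suc m = 1 / y"
    by (simp add: y_def field_simps)
  have r0: "r (Suc m) j = T"
    by (simp add: r_def racah_coeff_def T_def X_def Z_def D_def x_def y_def)
  have r1: "r (Suc m) (Suc j) = T * ((1 - x / y) * (1 - \<rho> * y * x)) * q / (P * (1 - q * x))"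
    unfolding r_def racah_coeff_def DS qpoch_Suc[of "inverse q ^ Suc m"] qpoch_Suc[of "\<rho> * q ^ Suc m"]
      X_def[symmetric]
    unfolding iy y_def[symmetric] x_def[symmetric] Z_def[symmetric]
    by (simp add: T_def x_def mult_ac)
  have d1: "r (Suc (Suc m)) (Suc j) - r (Suc m) (Suc j)
      = - (1 - q * x) * (1 - \<rho> * y\<^sup>2 * q) / (q * y) * (X * Z') / (D * (P * (1 - q * x))) * (q * x)"
    unfolding r_def racah_coeff_diff[OF nz(1)] DS
    using e(3) by (simp add: X_def Z'_def x_def y_def eval_nat_numeral power_add)
  have d2: "r (Suc m) (Suc j) - r m (Suc j)
      = - (1 - q * x) * (1 - \<rho> * y\<^sup>2 / q) / y * (X' * Z) / (D * (P * (1 - q * x))) * (q * x)"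
    unfolding r_def racah_coeff_diff[OF nz(1)] DS
    using e(1) by (simp add: X'_def Z_def x_def y_def)
  \<comment> \<open>Splitting off the first or the last factor of the same product of length j + 1
    relates \<open>Z'\<close> to \<open>Z\<close>, and below \<open>X'\<close> to \<open>X\<close>.
    These relations absorb the factors 1 - \<rho> y of \<open>racah_A\<close> and 1 - y of
    \<open>racah_C\<close>.\<close>
  have Z': "(1 - \<rho> * y) * Z' = Z * (1 - \<rho> * y * x)"
    using qpoch_Suc[of "\<rho> * y" q j] qpoch_Suc_left[of "\<rho> * y" q j]
    by (simp add: Z_def Z'_def x_def mult_ac)
  have "inverse q ^ Suc m * q = inverse q ^ m"
    using nz by simp
  then have "(1 - 1 / y) * X' = X * (1 - x / y)"
    using qpoch_Suc[of "inverse q ^ Suc m" q j] qpoch_Suc_left[of "inverse q ^ Suc m" q j]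
    unfolding X_def X'_def x_def iy[symmetric] by (metis divide_inverse_commute divide_inverse iy mult.commute mult_1)
  moreover have "1 - y = - y * (1 - 1 / y)"
    using xy by (simp add: field_simps)
  ultimately have X': "(1 - y) * X' = - y * X * (1 - x / y)"
    by (simp only: mult.assoc)
  have A: "racah_A q \<rho> A1 A2 A3 (Suc m) * (r (Suc (Suc m)) (Suc j) - r (Suc m) (Suc j))
      = - (T * S * (1 - \<rho> * y * x)) / (y * (1 - \<rho> * y\<^sup>2) * P)"
  proof -
    have "racah_A q \<rho> A1 A2 A3 (Suc m) = (1 - \<rho> * y) * S / ((1 - \<rho> * y\<^sup>2) * (1 - \<rho> * y\<^sup>2 * q))"
      by (simp add: racah_A_def S_def y_def eval_nat_numeral power_add mult_ac)
    moreover have "(1 - \<rho> * y) * S / ((1 - \<rho> * y\<^sup>2) * (1 - \<rho> * y\<^sup>2 * q)) *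
      (- (1 - q * x) * (1 - \<rho> * y\<^sup>2 * q) / (q * y) * (X * Z') / (D * (P * (1 - q * x))) * (q * x))
      = - (S * X * ((1 - \<rho> * y) * Z') / D * x) / (y * (1 - \<rho> * y\<^sup>2) * P)"
      using xy P qx \<rho>' nz by (simp add: divide_simps) (simp add: algebra_simps)
    ultimately show ?thesis
      unfolding d1 Z' by (simp add: T_def mult_ac)
  qed
  have C: "racah_C q \<rho> G A1 A2 A3 (Suc m) * (r m (Suc j) - r (Suc m) (Suc j))
      = - (T * S' * q * (1 - x / y)) / ((1 - \<rho> * y\<^sup>2) * P)"
  proof -
    have "racah_C q \<rho> G A1 A2 A3 (Suc m) = (1 - y) * S' / ((1 - \<rho> * y\<^sup>2 / q) * (1 - \<rho> * y\<^sup>2))"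
      using e by (simp add: racah_C_def S'_def y_def mult_ac)
    moreover have "(1 - y) * S' / ((1 - \<rho> * y\<^sup>2 / q) * (1 - \<rho> * y\<^sup>2)) *
      - (- (1 - q * x) * (1 - \<rho> * y\<^sup>2 / q) / y * (X' * Z) / (D * (P * (1 - q * x))) * (q * x))
      = (S' * ((1 - y) * X') * Z / D * (q * x)) / (y * (1 - \<rho> * y\<^sup>2) * P)"
      using xy P qx \<rho>' nz by (simp add: divide_simps) (simp add: algebra_simps)
    moreover have "r m (Suc j) - r (Suc m) (Suc j) = - (r (Suc m) (Suc j) - r m (Suc j))"
      by simp
    ultimately show ?thesis
      unfolding d2 X' using xy by (simp add: T_def mult_ac)
  qed
  have I: "((1 - G * q * x) * (1 - x / y) * (1 - \<rho> * y * x) - P) * (1 - \<rho> * y\<^sup>2)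
    = - (x * S * (1 - \<rho> * y * x) / y) - q * x * S' * (1 - x / y)"
    using racah_interpolation[OF nz(1) xy(2) nz(2-5) \<rho>'(2) G, of x]
    by (simp add: P_def S_def S'_def mult_ac)
  \<comment> \<open>Numerator and denominator are extended by 1 - \<rho> y^2 so that
    \<open>I\<close> applies.\<close>
  have "- (1 - 1 / (q * x)) * (1 - G * (q * x)) * (T * ((1 - x / y) * (1 - \<rho> * y * x)) * q / (P * (1 - q * x))) - T / x
     = T * (((1 - G * q * x) * (1 - x / y) * (1 - \<rho> * y * x) - P) * (1 - \<rho> * y\<^sup>2)) / (x * (1 - \<rho> * y\<^sup>2) * P)"
  proof -
    have "- (1 - 1 / (q * x)) = (1 - q * x) / (q * x)" using xy nz by (simp add: field_simps)
    then show ?thesis using xy P qx \<rho>'(2) nz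
      by (simp add: divide_simps) (simp add: algebra_simps)
  qed
  also have "\<dots> = - (T * S * (1 - \<rho> * y * x)) / (y * (1 - \<rho> * y\<^sup>2) * P)
      + - (T * S' * q * (1 - x / y)) / ((1 - \<rho> * y\<^sup>2) * P)"
    unfolding I using xy P \<rho>'(2) by (simp add: divide_simps) (simp add: algebra_simps)
  finally show ?thesis
    unfolding A C unfolding r0 r1 by (simp add: x_def)
qed

text \<open>For n = 0 the \<open>racah_C\<close> term is 0 and only the coefficient of (E, F; q)_1
  has to be compared. The cancelled form of \<open>racah_A\<close> covers \<rho> = 1 as
  well.\<close>

lemma racah_coeff_recurrence_0:
  fixes q :: "'a::field"
  assumes "q \<noteq> 0" "q \<noteq> 1" "A1 \<noteq> 1" "A2 \<noteq> 1" "A3 \<noteq> 1" "\<rho> * q \<noteq> 1"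
  shows "racah_A q \<rho> A1 A2 A3 0 * racah_coeff q \<rho> A1 A2 A3 (Suc 0) (Suc 0) = - 1"
  using assms by (simp add: racah_A_def racah_coeff_def qpoch_def divide_simps)

theorem racah_sum_recurrence:
  fixes q :: "'a::field"
  assumes nz: "q \<noteq> 0" "\<rho> \<noteq> 0" "A1 \<noteq> 0" "A2 \<noteq> 0" "A3 \<noteq> 0"
    and G: "q * \<rho> * G = A1 * A2 * A3" "E * F = G"
    and den: "\<And>j. j \<le> n \<Longrightarrow> A1 * q ^ j \<noteq> 1" "\<And>j. j \<le> n \<Longrightarrow> A2 * q ^ j \<noteq> 1"
      "\<And>j. j \<le> n \<Longrightarrow> A3 * q ^ j \<noteq> 1" "\<And>j. j \<le> n \<Longrightarrow> q ^ Suc j \<noteq> 1"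
    and \<rho>: "\<And>i. 2 * n - 1 \<le> i \<Longrightarrow> 1 \<le> i \<Longrightarrow> i \<le> 2 * n + 1 \<Longrightarrow> \<rho> * q ^ i \<noteq> 1"
  defines "R \<equiv> racah_sum q \<rho> A1 A2 A3 E F"
  shows "- (1 - E) * (1 - F) * R n =
    racah_A q \<rho> A1 A2 A3 n * (R (Suc n) - R n) + racah_C q \<rho> G A1 A2 A3 n * (R (n - 1) - R n)"
proof -
  define r where "r = racah_coeff q \<rho> A1 A2 A3"
  define \<phi> where "\<phi> k = qpoch E q k * qpoch F q k" for k
  define A C where "A = racah_A q \<rho> A1 A2 A3 n" and "C = racah_C q \<rho> G A1 A2 A3 n"
  have R: "R m = (\<Sum>k\<le>Suc n. r m k * \<phi> k)" if "m \<le> Suc n" for m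
    using racah_sum_extend[OF nz(1) that] by (simp add: R_def r_def \<phi>_def)
  \<comment> \<open>This rests on (1 - E)(1 - F) = (1 - q^(-k))(1 - G q^k) + (1 - E q^k)(1 - F q^k)
    / q^k, where G = E F.\<close>
  have step: "(1 - E) * (1 - F) * \<phi> k = (1 - 1 / q ^ k) * (1 - G * q ^ k) * \<phi> k + \<phi> (Suc k) / q ^ k" for k
    using nz by (simp add: \<phi>_def qpoch_Suc G(2)[symmetric] divide_simps) (simp add: algebra_simps)
  have coeff: "- (1 - 1 / q ^ Suc j) * (1 - G * q ^ Suc j) * r n (Suc j) - r n j / q ^ j
    = A * (r (Suc n) (Suc j) - r n (Suc j)) + C * (r (n - 1) (Suc j) - r n (Suc j))" if "j \<le> n" for j
  proof (cases n)
    case 0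
    then show ?thesis
      using that racah_coeff_recurrence_0[of q A1 A2 A3 \<rho>] nz den[of 0] \<rho>[of 1]
      by (simp add: r_def A_def C_def racah_C_def racah_coeff_eq_0)
  next
    case (Suc m)
    then show ?thesis
      unfolding r_def A_def C_def Suc diff_Suc_1
      using that
      by (intro racah_coeff_recurrence nz G(1) den \<rho>) (auto simp: Suc)
  qed
  have "(\<Sum>k\<le>Suc n. r n k * ((1 - E) * (1 - F) * \<phi> k)) = (1 - E) * (1 - F) * R n"
    by (simp add: R sum_distrib_left mult_ac del: sum.atMost_Suc)
  then have "- (1 - E) * (1 - F) * R n = - (\<Sum>k\<le>Suc n. r n k * ((1 - E) * (1 - F) * \<phi> k))"
    by (simp only: mult_minus_left)
  also have "\<dots> = - (\<Sum>k\<le>Suc n. (1 - 1 / q ^ k) * (1 - G * q ^ k) * r n k * \<phi> k)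
      - (\<Sum>k\<le>Suc n. r n k / q ^ k * \<phi> (Suc k))"
    unfolding step
    by (simp only: distrib_left sum.distrib minus_add_distrib) (simp add: mult_ac del: sum.atMost_Suc)
  \<comment> \<open>The term k = 0 drops out because 1 - 1 / q^0 = 0. Next k = n + 1 drops out
    because the coefficients vanish beyond n. At the end k = 0 can be added back because all
    coefficients of index 0 equal 1.\<close>
  also have "(\<Sum>k\<le>Suc n. (1 - 1 / q ^ k) * (1 - G * q ^ k) * r n k * \<phi> k)
      = (\<Sum>j\<le>n. (1 - 1 / q ^ Suc j) * (1 - G * q ^ Suc j) * r n (Suc j) * \<phi> (Suc j))"
    by (subst sum.atMost_Suc_shift) simp
  also have "(\<Sum>k\<le>Suc n. r n k / q ^ k * \<phi> (Suc k)) = (\<Sum>j\<le>n. r n j / q ^ j * \<phi> (Suc j))"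
    using nz by (simp add: r_def racah_coeff_eq_0)
  also have "- (\<Sum>j\<le>n. (1 - 1 / q ^ Suc j) * (1 - G * q ^ Suc j) * r n (Suc j) * \<phi> (Suc j)) - \<dots>
      = (\<Sum>j\<le>n. (- (1 - 1 / q ^ Suc j) * (1 - G * q ^ Suc j) * r n (Suc j) - r n j / q ^ j) * \<phi> (Suc j))"
    by (simp add: sum_negf[symmetric] sum_subtractf[symmetric] left_diff_distrib)
  also have "\<dots> = (\<Sum>j\<le>n. (A * (r (Suc n) (Suc j) - r n (Suc j)) + C * (r (n - 1) (Suc j) - r n (Suc j))) * \<phi> (Suc j))"
    by (intro sum.cong refl arg_cong2[where f = "(*)"] coeff) auto
  also have "\<dots> = (\<Sum>k\<le>Suc n. (A * (r (Suc n) k - r n k) + C * (r (n - 1) k - r n k)) * \<phi> k)"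
    by (subst sum.atMost_Suc_shift) (simp add: r_def)
  also have "\<dots> = A * (R (Suc n) - R n) + C * (R (n - 1) - R n)"
    by (simp add: R sum_distrib_left sum.distrib sum_subtractf algebra_simps del: sum.atMost_Suc)
  finally show ?thesis
    unfolding A_def C_def .
qed

section \<open>The \<open>q\<close>-Racah polynomials\<close>

lemma qpow_add: "0 < q \<Longrightarrow> qpow q (x + y) = qpow q x * qpow q y"
  by (simp add: powr_def distrib_right exp_add)

lemma qpow_minus: "qpow q (- x) = inverse (qpow q x)"
  by (simp add: powr_def exp_minus)

lemma qpow_diff: "0 < q \<Longrightarrow> qpow q (x - y) = qpow q x / qpow q y"
  by (simp add: powr_def left_diff_distrib exp_diff)

lemma qpow_of_nat: "0 < q \<Longrightarrow> qpow q (of_nat n) = of_real q ^ n"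
  by (simp add: powr_def exp_of_nat_mult)

lemma qpow_of_nat_mult: "0 < q \<Longrightarrow> qpow q (of_nat n * x) = qpow q x ^ n"
  by (simp add: powr_def exp_of_nat_mult mult.assoc)

lemma qpow_of_real: "0 < q \<Longrightarrow> qpow q (of_real x) = of_real (q powr x)"
  by (simp add: powr_of_real)

lemma qpow_1 [simp]: "0 < q \<Longrightarrow> qpow q 1 = of_real q"
  using qpow_of_nat[of q 1] by simp

lemma qpow_neq_0 [simp]: "0 < q \<Longrightarrow> qpow q x \<noteq> 0"
  by (simp add: powr_def)

lemma kappa_neq_0:
  assumes "0 < q" "q < 1"
  shows "kappa q \<noteq> 0"
proof
  assume "kappa q = 0"
  then have "qpow q (1/2) * qpow q (1/2) = qpow q (1/2) * qpow q (-1/2)"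
    by (simp add: kappa_def)
  then have "qpow q 1 = 1"
    using assms by (simp add: qpow_add[symmetric])
  then show False
    using assms by simp
qed

lemma lattice_c1_neq_0: "0 < q \<Longrightarrow> q < 1 \<Longrightarrow> lattice_c1 q \<noteq> 0"
  by (simp add: lattice_c1_def kappa_neq_0)

lemma lattice_c1_qpow:
  assumes "0 < q"
  shows "lattice_c1 q * qpow q (- a - 1) = qpow q (- (2 * a + 1) / 2) / kappa q ^ 2"
proof -
  have "qpow q (- (2 * a + 1) / 2) = qpow q (1/2) * qpow q (- a - 1)"
    unfolding qpow_add[OF assms, symmetric] by (simp add: field_simps)
  then show ?thesis by (simp add: lattice_c1_def)
qed

lemma qnum_eq:
  assumes "0 < q"
  shows "qnum q s = - qpow q (- s / 2) * (1 - qpow q s) / kappa q"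
proof -
  have "qpow q (s / 2) = qpow q (- s / 2) * qpow q s"
    unfolding qpow_add[OF assms, symmetric] by simp
  then show ?thesis
    by (simp add: qnum_def kappa_def algebra_simps)
qed

text \<open>Each q-number contributes -q^(-s/2) / kappa besides 1 - q^s. In the quotient the half
  powers combine to q^(-e/2), where e is the excess of the arguments above over those below, and two
  powers of kappa remain. This version serves n = 0, where a pair of q-numbers is cancelled
  beforehand.\<close>

lemma qnum_quotient_3_1:
  assumes q: "0 < q" "q < 1" and sum: "s1 + s2 + s3 = t + e"
  shows "qnum q s1 * qnum q s2 * qnum q s3 / qnum q t
    = qpow q (- e / 2) / kappa q ^ 2
      * ((1 - qpow q s1) * (1 - qpow q s2) * (1 - qpow q s3) / (1 - qpow q t))"
proof -
  have e: "- s1 + - s2 + - s3 = - e + - t"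
    using sum by algebra
  have "qpow q (- s1 / 2) * qpow q (- s2 / 2) * qpow q (- s3 / 2) = qpow q (- e / 2) * qpow q (- t / 2)"
    unfolding qpow_add[OF q(1), symmetric] add_divide_distrib[symmetric] e ..
  then have "qnum q s1 * qnum q s2 * qnum q s3
      = - (qpow q (- e / 2) * qpow q (- t / 2)) * ((1 - qpow q s1) * (1 - qpow q s2) * (1 - qpow q s3)) / kappa q ^ 3"
    unfolding qnum_eq[OF q(1)] by (simp add: eval_nat_numeral flip: mult.assoc)
  then show ?thesis
    unfolding qnum_eq[OF q(1), of t] using kappa_neq_0[OF q] q
    by (simp add: eval_nat_numeral mult_ac)
qed

lemma qnum_quotient_4_2:
  assumes q: "0 < q" "q < 1" and sum: "s1 + s2 + s3 + s4 = t1 + t2 + e"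
  shows "qnum q s1 * qnum q s2 * qnum q s3 * qnum q s4 / (qnum q t1 * qnum q t2)
    = qpow q (- e / 2) / kappa q ^ 2
      * ((1 - qpow q s1) * (1 - qpow q s2) * (1 - qpow q s3) * (1 - qpow q s4)
         / ((1 - qpow q t1) * (1 - qpow q t2)))"
proof -
  have e: "- s1 + - s2 + - s3 + - s4 = - e + - t1 + - t2"
    using sum by algebra
  have "qpow q (- s1 / 2) * qpow q (- s2 / 2) * qpow q (- s3 / 2) * qpow q (- s4 / 2)
      = qpow q (- e / 2) * qpow q (- t1 / 2) * qpow q (- t2 / 2)"
    unfolding qpow_add[OF q(1), symmetric] add_divide_distrib[symmetric] e ..
  then have "qnum q s1 * qnum q s2 * qnum q s3 * qnum q s4
      = (qpow q (- e / 2) * qpow q (- t1 / 2) * qpow q (- t2 / 2))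
        * ((1 - qpow q s1) * (1 - qpow q s2) * (1 - qpow q s3) * (1 - qpow q s4)) / kappa q ^ 4"
    unfolding qnum_eq[OF q(1)] by (simp add: eval_nat_numeral flip: mult.assoc)
  then show ?thesis
    unfolding qnum_eq[OF q(1), of t1] qnum_eq[OF q(1), of t2] using kappa_neq_0[OF q] q
    by (simp add: eval_nat_numeral mult_ac)
qed

text \<open>The tail is 0 because its numerators are, even where a parameter q^(-N) in
  \<open>ys\<close> makes a denominator 0.\<close>

lemma basic_hyp_terminating:
  assumes "q \<noteq> 0"
  shows "basic_hyp (inverse q ^ n # xs) ys q z
    = (\<Sum>k\<le>n. qpochs (inverse q ^ n # xs) q k / (qpochs ys q k * qpoch q q k) * z ^ k)"
  unfolding basic_hyp_def
  by (rule suminf_finite) (use assms in \<open>auto simp: qpochs_def qpoch_inverse_power_eq_0\<close>)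

lemma lattice_mu_minus_c3:
  assumes q: "0 < q" "q < 1"
  shows "lattice_mu q s - lattice_c3 q = lattice_c1 q * (qpow q s + qpow q (- s - 1))"
proof -
  \<comment> \<open>In terms of q^(1/2) and q^(s/2) all powers involved are monomials, and the claim
    becomes a rational identity.\<close>
  define h k where "h = qpow q (1/2)" and "k = qpow q (s/2)"
  have hk: "h \<noteq> 0" "k \<noteq> 0"
    using q by (simp_all add: h_def k_def)
  have e: "qpow q (-1/2) = inverse h" "qpow q ((s+1)/2) = k * h"
      "qpow q (- (s+1)/2) = inverse (k * h)" "qpow q (- s/2) = inverse k"
      "qpow q s = k * k" "qpow q (- s - 1) = inverse (k * k * (h * h))"
    unfolding h_def k_def qpow_add[OF q(1), symmetric] qpow_minus[symmetric]
    by (auto simp: add_divide_distrib diff_divide_distrib)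
  have "h * h = of_real q"
    unfolding h_def qpow_add[OF q(1), symmetric] using q by simp
  then have c3: "lattice_c3 q = - inverse h * (1 + h * h) / kappa q ^ 2"
    unfolding lattice_c3_def e by simp
  have c1: "lattice_c1 q = h / kappa q ^ 2"
    by (simp add: lattice_c1_def h_def)
  have "lattice_mu q s = (k - inverse k) / kappa q * ((k * h - inverse (k * h)) / kappa q)"
    unfolding lattice_mu_def qnum_def kappa_def e(2-4) k_def[symmetric] ..
  then show ?thesis
    unfolding c1 c3 e
    using kappa_neq_0[OF q] hk by (simp add: divide_simps power2_eq_square) (simp add: algebra_simps)
qed

section \<open>The q-Racah polynomials as rescaled balanced series\<close>

context
  fixes q :: real and \<alpha> \<beta> a b :: complex
  assumes q: "0 < q" "q < 1"
begin

abbreviation (input) "racah_rho \<equiv> qpow q (\<alpha> + \<beta> + 1)"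
abbreviation (input) "racah_G \<equiv> qpow q (2 * a + 1)"
abbreviation (input) "racah_A1 \<equiv> qpow q (a - b + 1)"
abbreviation (input) "racah_A2 \<equiv> qpow q (\<beta> + 1)"
abbreviation (input) "racah_A3 \<equiv> qpow q (a + b + \<alpha> + 1)"
text \<open>The factor h with \<mu>(s) - c_3 = h (E + F) for E = q^(a-s) and F = q^(a+s+1).\<close>

abbreviation (input) "racah_scale \<equiv> lattice_c1 q * qpow q (- a - 1)"
abbreviation (input) "rA \<equiv> racah_A (of_real q) racah_rho racah_A1 racah_A2 racah_A3"
abbreviation (input) "rC \<equiv> racah_C (of_real q) racah_rho racah_G racah_A1 racah_A2 racah_A3"
abbreviation (input) "rR s \<equiv> racah_sum (of_real q) racah_rho racah_A1 racah_A2 racah_A3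
  (qpow q (a - s)) (qpow q (a + s + 1))"

text \<open>The excess in \<open>qnum_quotient_4_2\<close> is 2 a + 1 for every n, hence the common
  factor \<open>racah_scale\<close>. For n = 0 the quotient of three by one has the same
  excess.\<close>

lemma qnum_term_A:
  "(if n = 0 then 1 else qnum q (\<alpha> + \<beta> + of_nat n + 1) / qnum q (\<alpha> + \<beta> + 2 * of_nat n + 1))
     * (qnum q (a - b + of_nat n + 1) * qnum q (\<beta> + of_nat n + 1) * qnum q (a + b + \<alpha> + of_nat n + 1)
        / qnum q (\<alpha> + \<beta> + 2 * of_nat n + 2))
   = racah_scale * rA n"
proof -
  have pw: "qpow q (\<alpha> + \<beta> + of_nat n + 1) = racah_rho * of_real q ^ n"
    "qpow q (\<alpha> + \<beta> + 2 * of_nat n + 1) = racah_rho * of_real q ^ (2 * n)"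
    "qpow q (\<alpha> + \<beta> + 2 * of_nat n + 2) = racah_rho * of_real q ^ (2 * n + 1)"
    "qpow q (a - b + of_nat n + 1) = racah_A1 * of_real q ^ n"
    "qpow q (\<beta> + of_nat n + 1) = racah_A2 * of_real q ^ n"
    "qpow q (a + b + \<alpha> + of_nat n + 1) = racah_A3 * of_real q ^ n"
    unfolding qpow_of_nat[OF q(1), symmetric] qpow_add[OF q(1), symmetric]
    by (simp_all add: algebra_simps)
  show ?thesis
  proof (cases "n = 0")
    case True
    have "qnum q (a - b + of_nat n + 1) * qnum q (\<beta> + of_nat n + 1) * qnum q (a + b + \<alpha> + of_nat n + 1)
        / qnum q (\<alpha> + \<beta> + 2 * of_nat n + 2)
      = qpow q (- (2 * a + 1) / 2) / kappa q ^ 2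
        * ((1 - qpow q (a - b + of_nat n + 1)) * (1 - qpow q (\<beta> + of_nat n + 1))
           * (1 - qpow q (a + b + \<alpha> + of_nat n + 1)) / (1 - qpow q (\<alpha> + \<beta> + 2 * of_nat n + 2)))"
      by (rule qnum_quotient_3_1[OF q]) (simp add: True)
    also have "\<dots> = racah_scale * rA n"
      unfolding pw lattice_c1_qpow[OF q(1)] racah_A_def using True by (simp only: if_True mult_1 refl)
    finally show ?thesis
      using True by simp
  next
    case False
    have "qnum q (\<alpha> + \<beta> + of_nat n + 1) * qnum q (a - b + of_nat n + 1) * qnum q (\<beta> + of_nat n + 1)
        * qnum q (a + b + \<alpha> + of_nat n + 1)
        / (qnum q (\<alpha> + \<beta> + 2 * of_nat n + 1) * qnum q (\<alpha> + \<beta> + 2 * of_nat n + 2))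
      = qpow q (- (2 * a + 1) / 2) / kappa q ^ 2
        * ((1 - qpow q (\<alpha> + \<beta> + of_nat n + 1)) * (1 - qpow q (a - b + of_nat n + 1))
           * (1 - qpow q (\<beta> + of_nat n + 1)) * (1 - qpow q (a + b + \<alpha> + of_nat n + 1))
           / ((1 - qpow q (\<alpha> + \<beta> + 2 * of_nat n + 1)) * (1 - qpow q (\<alpha> + \<beta> + 2 * of_nat n + 2))))"
      by (rule qnum_quotient_4_2[OF q]) simp
    also have "\<dots> = racah_scale * rA n"
      unfolding pw lattice_c1_qpow[OF q(1)] racah_A_def using False
      by (simp only: if_False times_divide_times_eq mult.assoc)
    finally show ?thesis
      using False by (simp only: if_False times_divide_times_eq mult.assoc)
  qed
qed

text \<open>Here the excess is -(2 a + 1), so the half power is inverse to that in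
  \<open>qnum_term_A\<close>. Writing it with \<open>racah_scale\<close> produces the factor
  q^(2a+1), which is the \<open>G\<close> in \<open>racah_C\<close>.\<close>

lemma qnum_term_C:
  "qnum q (\<alpha> + of_nat n) * qnum q (b - a + \<alpha> + \<beta> + of_nat n) * qnum q (- a - b + \<beta> + of_nat n)
     * qnum q (of_nat n) / (qnum q (\<alpha> + \<beta> + 2 * of_nat n) * qnum q (\<alpha> + \<beta> + 2 * of_nat n + 1))
   = racah_scale * rC n"
proof (cases "n = 0")
  case True
  then show ?thesis using q by (simp add: racah_C_def qnum_def)
next
  case False
  have pw: "qpow q (\<alpha> + of_nat n) = racah_rho / racah_A2 * of_real q ^ n"
    "qpow q (b - a + \<alpha> + \<beta> + of_nat n) = racah_rho / racah_A1 * of_real q ^ n"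
    "qpow q (- a - b + \<beta> + of_nat n) = racah_rho / racah_A3 * of_real q ^ n"
    "qpow q (of_nat n) = of_real q ^ n"
    "qpow q (\<alpha> + \<beta> + 2 * of_nat n) = racah_rho * of_real q ^ (2 * n - 1)"
    "qpow q (\<alpha> + \<beta> + 2 * of_nat n + 1) = racah_rho * of_real q ^ (2 * n)"
    "qpow q (- (- (2 * a + 1)) / 2) = racah_G * qpow q (- (2 * a + 1) / 2)"
    unfolding qpow_of_nat[OF q(1), symmetric] qpow_add[OF q(1), symmetric] qpow_diff[OF q(1), symmetric]
    using False by (simp_all add: field_simps of_nat_diff)
  have "qnum q (\<alpha> + of_nat n) * qnum q (b - a + \<alpha> + \<beta> + of_nat n) * qnum q (- a - b + \<beta> + of_nat n)
     * qnum q (of_nat n) / (qnum q (\<alpha> + \<beta> + 2 * of_nat n) * qnum q (\<alpha> + \<beta> + 2 * of_nat n + 1))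
    = qpow q (- (- (2 * a + 1)) / 2) / kappa q ^ 2
      * ((1 - qpow q (\<alpha> + of_nat n)) * (1 - qpow q (b - a + \<alpha> + \<beta> + of_nat n))
         * (1 - qpow q (- a - b + \<beta> + of_nat n)) * (1 - qpow q (of_nat n))
         / ((1 - qpow q (\<alpha> + \<beta> + 2 * of_nat n)) * (1 - qpow q (\<alpha> + \<beta> + 2 * of_nat n + 1))))"
    by (rule qnum_quotient_4_2[OF q]) simp
  also have "\<dots> = racah_scale * rC n"
    unfolding pw lattice_c1_qpow[OF q(1)] racah_C_def
    by (simp only: times_divide_eq_right times_divide_eq_left mult_ac)
  finally show ?thesis .
qed

lemma qRacah_beta_eq:
  "qRacah_beta q \<alpha> \<beta> a b n = lattice_c3 q + racah_scale * (1 + racah_G - rA n - rC n)"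
proof -
  have "qnum q a * qnum q (a + 1) = lattice_c3 q + lattice_c1 q * (qpow q a + qpow q (- a - 1))"
    using lattice_mu_minus_c3[OF q, of a] by (simp add: lattice_mu_def algebra_simps)
  also have "qpow q a = qpow q (- a - 1) * racah_G"
    unfolding qpow_add[OF q(1), symmetric] by simp
  finally show ?thesis
    unfolding qRacah_beta_def Let_def qnum_term_A qnum_term_C by (simp add: algebra_simps)
qed

text \<open>The q-numbers in \<gamma>_n are those of the first subtracted term of \<beta>_(n-1)
  together with those of the second subtracted term of \<beta>_n. The exceptional case n = 1 is that
  of \<open>racah_A\<close> at index 0.\<close>

lemma qRacah_gamma_eq:
  assumes "n \<ge> 1"
  shows "qRacah_gamma q \<alpha> \<beta> a b n = racah_scale\<^sup>2 * rA (n - 1) * rC n"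
proof -
  have m: "(of_nat (n - 1) :: complex) = of_nat n - 1"
    using assms by simp
  have e: "\<alpha> + \<beta> + of_nat (n - 1) + 1 = \<alpha> + \<beta> + of_nat n"
    "\<alpha> + \<beta> + 2 * of_nat (n - 1) + 1 = \<alpha> + \<beta> + 2 * of_nat n - 1"
    "\<alpha> + \<beta> + 2 * of_nat (n - 1) + 2 = \<alpha> + \<beta> + 2 * of_nat n"
    "a - b + of_nat (n - 1) + 1 = a - b + of_nat n"
    "\<beta> + of_nat (n - 1) + 1 = \<beta> + of_nat n"
    "a + b + \<alpha> + of_nat (n - 1) + 1 = a + b + \<alpha> + of_nat n"
    unfolding m by simp_all
  have n: "n - 1 = 0 \<longleftrightarrow> n = 1" using assms by auto
  have "qRacah_gamma q \<alpha> \<beta> a b n = (racah_scale * rA (n - 1)) * (racah_scale * rC n)"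
    unfolding qnum_term_A[symmetric] qnum_term_C[symmetric] e n qRacah_gamma_def Let_def
    by (simp add: power2_eq_square mult_ac)
  then show ?thesis by (simp add: power2_eq_square mult_ac)
qed

text \<open>What is left of the monic normalisation after the n-th power of
  \<open>racah_scale\<close> is split off.\<close>

definition qRacah_lead :: "nat \<Rightarrow> complex" where
  "qRacah_lead n = qpoch racah_A1 (of_real q) n * qpoch racah_A2 (of_real q) n * qpoch racah_A3 (of_real q) n
     / qpoch (racah_rho * of_real q ^ n) (of_real q) n"

lemma qRacah_eq: "qRacah q \<alpha> \<beta> a b n s = racah_scale ^ n * qRacah_lead n * rR s n"
proof -
  have "- (of_nat n / 2) * (2 * a + 1) = of_nat n * (- (2 * a + 1) / 2)"
    by (simp add: field_simps)
  then have 1: "qpow q (- (of_nat n / 2) * (2 * a + 1)) / kappa q ^ (2 * n) = racah_scale ^ n"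
    unfolding lattice_c1_qpow[OF q(1)] power_divide power_mult by (simp only: qpow_of_nat_mult[OF q(1)])
  have 2: "qpow q (\<alpha> + \<beta> + of_nat n + 1) = racah_rho * of_real q ^ n"
    unfolding qpow_of_nat[OF q(1), symmetric] qpow_add[OF q(1), symmetric] by (simp add: algebra_simps)
  have 3: "qpow q (- of_nat n) = inverse (of_real q) ^ n"
    using q by (simp add: qpow_minus qpow_of_nat power_inverse)
  have 4: "complex_of_real q \<noteq> 0" using q by simp
  have "qRacah q \<alpha> \<beta> a b n s =
    qpow q (- (of_nat n / 2) * (2 * a + 1)) / kappa q ^ (2 * n) * qRacah_lead n * rR s n"
    unfolding qRacah_def 2 3 basic_hyp_terminating[OF 4] qRacah_lead_def racah_sum_def racah_coeff_def
    by (simp add: qpochs_def mult_ac)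
  then show ?thesis unfolding 1 .
qed

text \<open>This gives u_(n+1) the coefficient 1 in the recurrence. From n to n + 1 the product in
  the denominator changes both its start and its length; splitting off its first or last factor
  gives the quotient of 1 - p and 1 - p q^n.\<close>

lemma qRacah_lead_Suc:
  assumes "\<And>i. i \<ge> 1 \<Longrightarrow> racah_rho * of_real q ^ i \<noteq> 1"
  shows "qRacah_lead (Suc n) = qRacah_lead n * rA n"
proof (cases "n = 0")
  case True
  then show ?thesis by (simp add: qRacah_lead_def racah_A_def qpoch_def)
next
  case False
  define p where "p = racah_rho * of_real q ^ n"
  have p: "racah_rho * of_real q ^ Suc n = p * of_real q"
    "racah_rho * of_real q ^ (2 * n) = p * of_real q ^ n"
    "racah_rho * of_real q ^ (2 * n + 1) = p * of_real q * of_real q ^ n"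
    by (simp_all add: p_def mult_2 mult_2_right power_add mult_ac)
  have "p \<noteq> 1" "p * of_real q ^ n \<noteq> 1"
    unfolding p_def mult.assoc power_add[symmetric] using False by (auto intro!: assms)
  moreover have "qpoch p (of_real q) n * (1 - p * of_real q ^ n) = (1 - p) * qpoch (p * of_real q) (of_real q) n"
    by (metis qpoch_Suc qpoch_Suc_left)
  ultimately have "qpoch (p * of_real q) (of_real q) n = qpoch p (of_real q) n * (1 - p * of_real q ^ n) / (1 - p)"
    by simp
  then show ?thesis
    unfolding qRacah_lead_def racah_A_def p p_def[symmetric] qpoch_Suc
    using False \<open>p \<noteq> 1\<close> by (simp add: mult_ac)
qed

text \<open>The condition on q^(a-b+1) stops at j = n because for a - b + 1 = -N it fails at j =
  N.\<close>

theorem qRacah_recurrence: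
  assumes \<rho>: "\<And>i. i \<ge> 1 \<Longrightarrow> racah_rho * of_real q ^ i \<noteq> 1"
    and A: "\<And>j. j \<le> n \<Longrightarrow> racah_A1 * of_real q ^ j \<noteq> 1" "\<And>j. j \<le> n \<Longrightarrow> racah_A2 * of_real q ^ j \<noteq> 1"
      "\<And>j. j \<le> n \<Longrightarrow> racah_A3 * of_real q ^ j \<noteq> 1"
  defines "u \<equiv> qRacah q \<alpha> \<beta> a b"
  shows "lattice_mu q s * u n s = u (n + 1) s + qRacah_beta q \<alpha> \<beta> a b n * u n s
    + qRacah_gamma q \<alpha> \<beta> a b n * (if n = 0 then 0 else u (n - 1) s)"
proof -
  define h L R A C E F G where h: "h = racah_scale" and L: "L = qRacah_lead" and R: "R = rR s"
    and A': "A = rA" and C': "C = rC" and E: "E = qpow q (a - s)" and F: "F = qpow q (a + s + 1)"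
    and G: "G = racah_G"
  have qj: "of_real q ^ Suc j \<noteq> (1 :: complex)" for j
  proof
    assume "of_real q ^ Suc j = (1 :: complex)"
    then have "q ^ Suc j = 1"
      unfolding of_real_power[symmetric] of_real_eq_1_iff .
    then show False
      using power_Suc_less_one[OF q, of j] by linarith
  qed
  have EF: "E * F = G"
    unfolding E F G qpow_add[OF q(1), symmetric] by (simp add: algebra_simps)
  have "qpow q 1 * racah_rho * G = racah_A1 * racah_A2 * racah_A3"
    unfolding G qpow_add[OF q(1), symmetric] by (simp add: algebra_simps)
  then have "of_real q * racah_rho * G = racah_A1 * racah_A2 * racah_A3"
    unfolding qpow_1[OF q(1)] .
  moreover have "of_real q \<noteq> (0 :: complex)" "racah_rho \<noteq> 0" "racah_A1 \<noteq> 0" "racah_A2 \<noteq> 0" "racah_A3 \<noteq> 0"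
    using q by simp_all
  ultimately have rec: "- (1 - E) * (1 - F) * R n = A n * (R (Suc n) - R n) + C n * (R (n - 1) - R n)"
    unfolding A' C' R E[symmetric] F[symmetric] G[symmetric]
    using EF A \<rho> qj by (intro racah_sum_recurrence) blast+
  have "lattice_mu q s = lattice_c3 q + lattice_c1 q * (qpow q s + qpow q (- s - 1))"
    using lattice_mu_minus_c3[OF q, of s] by (simp add: algebra_simps)
  also have "\<dots> = lattice_c3 q + h * (E + F)"
    unfolding h E F distrib_left mult.assoc qpow_add[OF q(1), symmetric] by (simp add: algebra_simps)
  finally have mu: "lattice_mu q s = lattice_c3 q + h * (E + F)" .
  have u: "u m s = h ^ m * L m * R m" for m
    unfolding u_def qRacah_eq h L R ..
  have LS: "L (Suc m) = L m * A m" for m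
    unfolding L A' by (rule qRacah_lead_Suc) (rule \<rho>)
  have \<beta>: "qRacah_beta q \<alpha> \<beta> a b n = lattice_c3 q + h * (1 + G - A n - C n)"
    unfolding qRacah_beta_eq h A' C' G ..
  \<comment> \<open>For n >= 1 the factor A_(n-1) of \<gamma>_n turns L_(n-1) into L_n; for n = 0
    both sides are 0.\<close>
  have \<gamma>: "qRacah_gamma q \<alpha> \<beta> a b n * (if n = 0 then 0 else u (n - 1) s) = h * C n * (h ^ n * L n) * R (n - 1)"
  proof (cases n)
    case 0
    then show ?thesis by (simp add: C' racah_C_def)
  next
    case (Suc m)
    then show ?thesis
      using qRacah_gamma_eq[of n] by (simp add: LS u A'[symmetric] C'[symmetric] h[symmetric] power2_eq_square)
  qed
  \<comment> \<open>Uses E + F = 1 + E F - (1 - E)(1 - F).\<close>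
  have EF_R: "(E + F) * R n = (1 + G) * R n + (A n * (R (Suc n) - R n) + C n * (R (n - 1) - R n))"
    unfolding rec[symmetric] EF[symmetric] by (simp add: algebra_simps)
  have "lattice_mu q s * u n s = lattice_c3 q * u n s + h ^ n * L n * h * ((E + F) * R n)"
    unfolding mu u by (simp add: algebra_simps)
  also have "\<dots> = u (n + 1) s + qRacah_beta q \<alpha> \<beta> a b n * u n s
      + qRacah_gamma q \<alpha> \<beta> a b n * (if n = 0 then 0 else u (n - 1) s)"
    unfolding EF_R \<beta> \<gamma> unfolding u by (simp add: LS algebra_simps)
  finally show ?thesis .
qed

end

section \<open>Limits of the rescaled quantities\<close>

lemma of_real_qpoch: "of_real (qpoch x q k) = qpoch (of_real x) (of_real q) k"
  by (simp add: qpoch_def)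

lemma of_real_racah_sum:
  "(of_real (racah_sum q \<rho> A1 A2 A3 E F n) :: complex)
    = racah_sum (of_real q) (of_real \<rho>) (of_real A1) (of_real A2) (of_real A3) (of_real E) (of_real F) n"
  by (simp add: racah_sum_def racah_coeff_def of_real_qpoch)

lemma of_real_racah_A:
  "(of_real (racah_A q \<rho> A1 A2 A3 n) :: complex)
    = racah_A (of_real q) (of_real \<rho>) (of_real A1) (of_real A2) (of_real A3) n"
  by (simp add: racah_A_def)

lemma of_real_racah_C:
  "(of_real (racah_C q \<rho> G A1 A2 A3 n) :: complex)
    = racah_C (of_real q) (of_real \<rho>) (of_real G) (of_real A1) (of_real A2) (of_real A3) n"
  by (simp add: racah_C_def)

text \<open>Removes the poles at d = 0, so that limits for d = q^N can be taken factor by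
  factor.\<close>

lemma qpoch_divide:
  fixes x :: "'a::field"
  assumes "d \<noteq> 0"
  shows "d ^ k * qpoch (x / d) q k = (\<Prod>i<k. d - x * q ^ i)"
proof -
  have "d * (1 - x / d * q ^ i) = d - x * q ^ i" for i
    using assms by (simp add: field_simps)
  moreover have "d ^ k * qpoch (x / d) q k = (\<Prod>i<k. d * (1 - x / d * q ^ i))"
    by (simp add: qpoch_def prod.distrib)
  ultimately show ?thesis by simp
qed

lemma tendsto_qpoch_quotient:
  fixes q w :: real
  assumes q: "0 < q" "q < 1"
  shows "(\<lambda>N. qpoch (w / q ^ N) q k / qpoch (1 / q ^ N) q k) \<longlonglongrightarrow> w ^ k"
proof -
  have "(\<lambda>N. (\<Prod>i<k. q ^ N - w * q ^ i) / (\<Prod>i<k. q ^ N - 1 * q ^ i))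
      \<longlonglongrightarrow> (\<Prod>i<k. 0 - w * q ^ i) / (\<Prod>i<k. 0 - 1 * q ^ i)"
    using q by (intro tendsto_intros LIMSEQ_power_zero) auto
  also have "(\<Prod>i<k. 0 - w * q ^ i) / (\<Prod>i<k. 0 - 1 * q ^ i) = w ^ k"
    using q by (simp add: prod_dividef[symmetric])
  finally have "(\<lambda>N. (\<Prod>i<k. q ^ N - w * q ^ i) / (\<Prod>i<k. q ^ N - 1 * q ^ i)) \<longlonglongrightarrow> w ^ k" .
  \<comment> \<open>For N < k both denominators contain the factor 0, and both quotients are 0 by
    convention.\<close>
  moreover have "(\<Prod>i<k. q ^ N - w * q ^ i) / (\<Prod>i<k. q ^ N - 1 * q ^ i)
      = qpoch (w / q ^ N) q k / qpoch (1 / q ^ N) q k" for N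
  proof -
    have nz: "q ^ N \<noteq> 0" using q by simp
    show ?thesis
      unfolding qpoch_divide[OF nz, of k w q, symmetric] qpoch_divide[OF nz, of k 1 q, symmetric]
      using nz q by simp
  qed
  ultimately show ?thesis
    by (simp only:)
qed

text \<open>The product on the left is the limit of (q^N)^n (q^(-N); q)_n; the right side occurs in
  the normalisation of \<open>bigqJacobi\<close>.\<close>

lemma power_mult_prod_power:
  fixes q :: "'a::comm_ring_1"
  shows "q ^ n * (\<Prod>i<n. 0 - q ^ i) = (- 1) ^ n * q ^ (n * (n + 1) div 2)"
proof (induction n)
  case (Suc n)
  have "Suc n * (Suc n + 1) div 2 = n * (n + 1) div 2 + Suc n"
    by simp
  then have "(- 1) ^ Suc n * q ^ (Suc n * (Suc n + 1) div 2)
      = - ((- 1) ^ n * q ^ (n * (n + 1) div 2)) * q ^ Suc n"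
    by (simp only: power_add power_Suc) (simp add: mult_ac)
  then show ?case
    unfolding Suc.IH[symmetric] by (simp add: mult_ac)
qed simp

text \<open>The n powers of q^N in front are absorbed by the prefactor (q^(-N); q)_n, and in each
  term (w / q^N; q)_k / (q^(-N); q)_k tends to w^k. With z = q ta w the parameter e is q tc / z and
  q^k w^k is the power of z / ta, so the 4phi3 becomes the 3phi2.\<close>

theorem tendsto_racah_bigqJacobi:
  fixes q ta tb tc e w :: real
  assumes q: "0 < q" "q < 1" and ta: "ta \<noteq> 0" and w: "w \<noteq> 0" and ew: "e * w = tc / ta"
  shows "(\<lambda>N. (q ^ (N + 1) * ta) ^ n
      * (qpoch (1 / q ^ N) q n * qpoch (q * tb) q n * qpoch (q * tc) q n / qpoch (q * ta * tb * q ^ n) q n)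
      * racah_sum q (q * ta * tb) (1 / q ^ N) (q * tb) (q * tc) e (w / q ^ N) n)
    \<longlonglongrightarrow> bigqJacobi n (q * ta * w) ta tb tc q"
proof -
  have e: "q * tc * inverse (q * ta * w) = e" and w': "q * ta * w / ta = q * w"
    using ew q ta w by (simp_all add: field_simps)
  have rho: "ta * tb * q ^ (n + 1) = q * ta * tb * q ^ n"
    by (simp add: mult_ac)
  have q0: "q \<noteq> 0" using q by simp
  let ?r = "\<lambda>k. qpoch (inverse q ^ n) q k * qpoch (q * ta * tb * q ^ n) q k
      / (qpoch (q * tb) q k * qpoch (q * tc) q k * qpoch q q k) * q ^ k"
  have P: "bigqJacobi n (q * ta * w) ta tb tc q
    = (q * ta) ^ n * (\<Prod>i<n. 0 - 1 * q ^ i)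
      * (qpoch (q * tb) q n * qpoch (q * tc) q n / qpoch (q * ta * tb * q ^ n) q n)
      * (\<Sum>k\<le>n. ?r k * qpoch e q k * w ^ k)"
  proof -
    have "(- ta) ^ n * q ^ (n * (n + 1) div 2) = ta ^ n * ((- 1) ^ n * q ^ (n * (n + 1) div 2))"
      by (simp add: power_minus[of ta])
    also have "\<dots> = (q * ta) ^ n * (\<Prod>i<n. 0 - 1 * q ^ i)"
      unfolding power_mult_prod_power[symmetric] by (simp add: power_mult_distrib)
    finally have lead: "(- ta) ^ n * q ^ (n * (n + 1) div 2) = (q * ta) ^ n * (\<Prod>i<n. 0 - 1 * q ^ i)" .
    show ?thesis
      unfolding bigqJacobi_def basic_hyp_terminating[OF q0] rho lead e w'
      by (simp add: qpochs_def power_mult_distrib mult_ac)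
  qed
  have "(\<lambda>N. (q * ta) ^ n * (\<Prod>i<n. q ^ N - 1 * q ^ i)
      * (qpoch (q * tb) q n * qpoch (q * tc) q n / qpoch (q * ta * tb * q ^ n) q n)
      * (\<Sum>k\<le>n. ?r k * qpoch e q k * (qpoch (w / q ^ N) q k / qpoch (1 / q ^ N) q k)))
    \<longlonglongrightarrow> bigqJacobi n (q * ta * w) ta tb tc q"
    unfolding P
    using q by (intro tendsto_mult[OF tendsto_mult[OF tendsto_mult]] tendsto_const tendsto_prod tendsto_sum
        tendsto_diff tendsto_mult tendsto_qpoch_quotient LIMSEQ_power_zero) auto
  moreover have "(q ^ (N + 1) * ta) ^ n
      * (qpoch (1 / q ^ N) q n * qpoch (q * tb) q n * qpoch (q * tc) q n / qpoch (q * ta * tb * q ^ n) q n)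
      * racah_sum q (q * ta * tb) (1 / q ^ N) (q * tb) (q * tc) e (w / q ^ N) n
    = (q * ta) ^ n * (\<Prod>i<n. q ^ N - 1 * q ^ i)
      * (qpoch (q * tb) q n * qpoch (q * tc) q n / qpoch (q * ta * tb * q ^ n) q n)
      * (\<Sum>k\<le>n. ?r k * qpoch e q k * (qpoch (w / q ^ N) q k / qpoch (1 / q ^ N) q k))" for N
  proof -
    have nz: "q ^ N \<noteq> 0" using q by simp
    have "(q ^ (N + 1) * ta) ^ n = (q * ta) ^ n * (q ^ N) ^ n"
      by (simp add: power_mult_distrib mult_ac)
    then show ?thesis
      unfolding qpoch_divide[OF nz, of n 1 q, symmetric]
      by (simp add: racah_sum_def racah_coeff_def mult_ac)
  qed
  ultimately show ?thesis
    by (simp only:)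
qed

section \<open>The recurrence coefficients and their limits\<close>

lemma bigqJacobi_beta_eq_alt:
  assumes "\<And>i. i \<ge> 2 \<Longrightarrow> ta * tb * q ^ i \<noteq> 1" and tc: "tc \<noteq> 0"
  shows "bigqJacobi_beta q ta tb tc n = bigqJacobi_beta_alt q ta tb tc n"
proof (cases "n = 0")
  case True
  have "ta * tb * q\<^sup>2 \<noteq> 1" using assms(1)[of 2] by simp
  then show ?thesis
    using True by (simp add: bigqJacobi_beta_def bigqJacobi_beta_alt_def field_simps power2_eq_square)
next
  case False
  define p where "p = q ^ n"
  have pw: "q ^ (n + 1) = p * q" "q ^ (2 * n) = p * p" "q ^ (2 * n + 1) = p * p * q" "q ^ (2 * n + 2) = p * p * q * q"
    by (simp_all add: p_def mult_2 power_add)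
  have "1 - ta * tb * (p * p) \<noteq> 0" "1 - ta * tb * (p * p * q) \<noteq> 0" "1 - ta * tb * (p * p * q * q) \<noteq> 0"
    using assms(1)[of "2 * n"] assms(1)[of "2 * n + 1"] assms(1)[of "2 * n + 2"] False
    unfolding pw by auto
  then show ?thesis
    unfolding bigqJacobi_beta_def bigqJacobi_beta_alt_def pw p_def[symmetric] using False tc
    by (simp add: divide_simps) (simp add: algebra_simps)
qed

text \<open>Only the parameter 1 / d is singular at d = 0, and multiplication by d turns its factor
  into d - q^n.\<close>

lemma racah_A_scaled:
  fixes q :: "'a::field"
  assumes "d \<noteq> 0"
  shows "d * racah_A q (q * ta * tb) (1 / d) (q * tb) (q * tc) n
    = (d - q ^ n) * ((if n = 0 then 1 else (1 - q * ta * tb * q ^ n) / (1 - q * ta * tb * q ^ (2 * n)))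
      * ((1 - q * tb * q ^ n) * (1 - q * tc * q ^ n) / (1 - q * ta * tb * q ^ (2 * n + 1))))"
proof -
  have "d - q ^ n = d * (1 - 1 / d * q ^ n)"
    using assms by (simp add: field_simps)
  then show ?thesis
    unfolding racah_A_def by (simp only: times_divide_eq_right mult_ac)
qed

text \<open>Here the pole sits in G = tc / (ta d), while \<rho> / A1 = q ta tb d is regular.\<close>

lemma racah_C_scaled:
  fixes q :: "'a::field"
  assumes "d \<noteq> 0" "q \<noteq> 0" "ta \<noteq> 0" "tb \<noteq> 0" "tc \<noteq> 0"
  shows "d * ta * racah_C q (q * ta * tb) (tc / ta / d) (1 / d) (q * tb) (q * tc) n
    = (1 - q * ta * tb * q ^ n * d) * (tc * ((1 - q ^ n) * (1 - ta * q ^ n) * (1 - ta * tb / tc * q ^ n)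
       / ((1 - q * ta * tb * q ^ (2 * n - 1)) * (1 - q * ta * tb * q ^ (2 * n)))))"
proof -
  have e: "q * ta * tb / (1 / d) * q ^ n = q * ta * tb * q ^ n * d" "q * ta * tb / (q * tb) = ta"
    "q * ta * tb / (q * tc) = ta * tb / tc"
    using assms by simp_all
  have "d * ta * (tc / ta / d * x1 * x2 * x3 * x4 / y) = x2 * (tc * (x1 * x3 * x4 / y))" for x1 x2 x3 x4 y
    using assms by simp
  then show ?thesis
    unfolding racah_C_def e .
qed

text \<open>The expression is affine in d = q^N, and the limit is its value at d = 0. The term tc /
  (ta d) survives as q tc, which leads to the alternative form of the coefficient.\<close>

lemma tendsto_racah_beta:
  fixes q ta tb tc :: real
  assumes q: "0 < q" "q < 1" and nz: "ta \<noteq> 0" "tb \<noteq> 0" "tc \<noteq> 0"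
  shows "(\<lambda>N. q ^ (N + 1) * ta * (1 + tc / ta / q ^ N
      - racah_A q (q * ta * tb) (1 / q ^ N) (q * tb) (q * tc) n
      - racah_C q (q * ta * tb) (tc / ta / q ^ N) (1 / q ^ N) (q * tb) (q * tc) n))
    \<longlonglongrightarrow> bigqJacobi_beta_alt q ta tb tc n"
proof -
  define K1 where "K1 = (if n = 0 then 1 else (1 - q * ta * tb * q ^ n) / (1 - q * ta * tb * q ^ (2 * n)))
      * ((1 - q * tb * q ^ n) * (1 - q * tc * q ^ n) / (1 - q * ta * tb * q ^ (2 * n + 1)))"
  define K2 where "K2 = tc * ((1 - q ^ n) * (1 - ta * q ^ n) * (1 - ta * tb / tc * q ^ n)
       / ((1 - q * ta * tb * q ^ (2 * n - 1)) * (1 - q * ta * tb * q ^ (2 * n))))"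
  have "(\<lambda>N. q * ta * q ^ N + q * tc - q * ta * ((q ^ N - q ^ n) * K1) - q * ((1 - q * ta * tb * q ^ n * q ^ N) * K2))
      \<longlonglongrightarrow> q * ta * 0 + q * tc - q * ta * ((0 - q ^ n) * K1) - q * ((1 - q * ta * tb * q ^ n * 0) * K2)"
    using q by (intro tendsto_add tendsto_diff tendsto_mult tendsto_const LIMSEQ_power_zero) auto
  moreover have "q * ta * q ^ N + q * tc - q * ta * ((q ^ N - q ^ n) * K1) - q * ((1 - q * ta * tb * q ^ n * q ^ N) * K2)
      = q ^ (N + 1) * ta * (1 + tc / ta / q ^ N
      - racah_A q (q * ta * tb) (1 / q ^ N) (q * tb) (q * tc) n
      - racah_C q (q * ta * tb) (tc / ta / q ^ N) (1 / q ^ N) (q * tb) (q * tc) n)" for N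
  proof -
    define d where "d = q ^ N"
    have d: "d \<noteq> 0" "q \<noteq> 0" using q by (auto simp: d_def)
    have eq: "q ^ (N + 1) * ta * (1 + tc / ta / d - x - y) = q * ta * d + q * tc - q * ta * (d * x) - q * (d * ta * y)" for x y
      using d nz by (simp add: d_def[symmetric] field_simps)
    show ?thesis
      unfolding d_def[symmetric] K1_def K2_def eq racah_A_scaled[OF d(1)] racah_C_scaled[OF d nz] ..
  qed
  moreover have "q * ta * 0 + q * tc - q * ta * ((0 - q ^ n) * K1) - q * ((1 - q * ta * tb * q ^ n * 0) * K2)
      = bigqJacobi_beta_alt q ta tb tc n"
  \<comment> \<open>The exponent 2 n - 1 is truncated only for n = 0, where \<open>K2\<close> is
    0.\<close>
  proof (cases n)
    case 0
    then show ?thesis by (simp add: bigqJacobi_beta_alt_def K1_def K2_def power2_eq_square mult_ac)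
  next
    case (Suc m)
    then have "q * q ^ (2 * n - 1) = q ^ (2 * n)"
      by simp
    then have "q * ta * tb * q ^ (2 * n - 1) = ta * tb * q ^ (2 * n)"
      by (simp add: mult_ac)
    then show ?thesis
      using Suc by (simp add: bigqJacobi_beta_alt_def K1_def K2_def divide_inverse[of _ tc] mult_ac)
  qed
  ultimately show ?thesis by simp
qed

text \<open>One of the two factors q^N removes the pole of \<open>racah_A\<close>, the other that of
  \<open>racah_C\<close>.\<close>

lemma tendsto_racah_gamma:
  fixes q ta tb tc :: real
  assumes q: "0 < q" "q < 1" and nz: "ta \<noteq> 0" "tb \<noteq> 0" "tc \<noteq> 0"
  shows "(\<lambda>N. (q ^ (N + 1) * ta)\<^sup>2
      * racah_A q (q * ta * tb) (1 / q ^ N) (q * tb) (q * tc) n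
      * racah_C q (q * ta * tb) (tc / ta / q ^ N) (1 / q ^ N) (q * tb) (q * tc) (Suc n))
    \<longlonglongrightarrow> bigqJacobi_gamma q ta tb tc (Suc n)"
proof -
  define K1 where "K1 = (if n = 0 then 1 else (1 - q * ta * tb * q ^ n) / (1 - q * ta * tb * q ^ (2 * n)))
      * ((1 - q * tb * q ^ n) * (1 - q * tc * q ^ n) / (1 - q * ta * tb * q ^ (2 * n + 1)))"
  define K2 where "K2 = tc * ((1 - q ^ Suc n) * (1 - ta * q ^ Suc n) * (1 - ta * tb / tc * q ^ Suc n)
       / ((1 - q * ta * tb * q ^ (2 * Suc n - 1)) * (1 - q * ta * tb * q ^ (2 * Suc n))))"
  have "(\<lambda>N. q\<^sup>2 * ta * ((q ^ N - q ^ n) * K1) * ((1 - q * ta * tb * q ^ Suc n * q ^ N) * K2))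
      \<longlonglongrightarrow> q\<^sup>2 * ta * ((0 - q ^ n) * K1) * ((1 - q * ta * tb * q ^ Suc n * 0) * K2)"
    using q by (intro tendsto_diff tendsto_mult tendsto_const LIMSEQ_power_zero) auto
  moreover have "q\<^sup>2 * ta * ((q ^ N - q ^ n) * K1) * ((1 - q * ta * tb * q ^ Suc n * q ^ N) * K2)
      = (q ^ (N + 1) * ta)\<^sup>2
      * racah_A q (q * ta * tb) (1 / q ^ N) (q * tb) (q * tc) n
      * racah_C q (q * ta * tb) (tc / ta / q ^ N) (1 / q ^ N) (q * tb) (q * tc) (Suc n)" for N
  proof -
    define d where "d = q ^ N"
    have d: "d \<noteq> 0" "q \<noteq> 0" using q by (auto simp: d_def)
    have eq: "(q ^ (N + 1) * ta)\<^sup>2 * x * y = q\<^sup>2 * ta * (d * x) * (d * ta * y)" for x y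
      by (simp add: d_def power2_eq_square mult_ac)
    show ?thesis
      unfolding d_def[symmetric] K1_def K2_def eq racah_A_scaled[OF d(1)] racah_C_scaled[OF d nz] ..
  qed
  moreover have "q\<^sup>2 * ta * ((0 - q ^ n) * K1) * ((1 - q * ta * tb * q ^ Suc n * 0) * K2)
      = bigqJacobi_gamma q ta tb tc (Suc n)"
    by (simp add: bigqJacobi_gamma_def K1_def K2_def divide_inverse[of _ tc] power2_eq_square mult_ac)
  ultimately show ?thesis by simp
qed

section \<open>The rescaling by \<open>C\<^sub>n\<close>\<close>

text \<open>At the points s = N - k the parameter of size q^(-N) is the first one, at s = k the
  second.\<close>

lemma racah_sum_commute: "racah_sum q \<rho> A1 A2 A3 E F n = racah_sum q \<rho> A1 A2 A3 F E n"
  by (simp add: racah_sum_def mult_ac)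

text \<open>The powers of q^a, which need not be real, cancel here and a real factor
  remains.\<close>

lemma scaling_K_mult_scale:
  assumes "0 < q" "q < 1"
  shows "scaling_K q ta N a * (lattice_c1 q * qpow q (- a - 1)) = of_real (q ^ (N + 1) * ta)"
proof -
  have "qpow q (a + 1) * qpow q (- a - 1) = 1"
    unfolding qpow_add[OF assms(1), symmetric] using assms by simp
  then show ?thesis
    using lattice_c1_neq_0[OF assms] by (simp add: scaling_K_def)
qed

lemma mu_tilde_eq: "mu_tilde q ta N a s = scaling_K q ta N a * (lattice_mu q (s + a) - lattice_c3 q)"
  by (simp add: mu_tilde_def scaling_K_def)

lemma scaling_K_neq_0:
  assumes "0 < q" "q < 1" "ta \<noteq> 0"
  shows "scaling_K q ta N a \<noteq> 0"
  using assms lattice_c1_neq_0[of q] by (simp add: scaling_K_def)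

text \<open>Since (a + b) / 2 = a + (N + 1) / 2, the chosen branch of the square root combines with
  q^(N/2) to q^N q^(a+1/2) without ambiguity of sign.\<close>

lemma scaling_C_eq:
  assumes q: "0 < q" "q < 1" and ba: "b - a = of_nat N + 1"
  shows "scaling_C q ta N a b n = scaling_K q ta N a ^ n"
proof -
  have "(q ^ N) powr (real n / 2) = q powr (real N * (real n / 2))"
    using q by (simp add: powr_realpow[symmetric] powr_powr)
  then have "complex_of_real ((q ^ N) powr (real n / 2)) = qpow q (of_real (real N * (real n / 2)))"
    using q by (simp only: qpow_of_real)
  also have "(of_real (real N * (real n / 2)) :: complex) = of_nat n * (of_nat N / 2)"
    by simp
  also have "qpow q (of_nat n * (of_nat N / 2)) = qpow q (of_nat N / 2) ^ n"
    by (rule qpow_of_nat_mult[OF q(1)])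
  finally have 1: "complex_of_real ((q ^ N) powr (real n / 2)) = qpow q (of_nat N / 2) ^ n" .
  have b: "b = a + (of_nat N + 1)"
    using ba by (simp add: algebra_simps)
  have "qpow q (of_nat N / 2) * qpow q ((a + b) / 2) = qpow q (of_nat N) * qpow q (a + 1 / 2)"
    unfolding qpow_add[OF q(1), symmetric] b by (simp add: field_simps)
  moreover have "qpow q (a + 1) = qpow q (1 / 2) * qpow q (a + 1 / 2)"
    unfolding qpow_add[OF q(1), symmetric] by (simp add: add.commute)
  ultimately have "qpow q (of_nat N / 2) * of_real (q * ta) * qpow q ((a + b) / 2) * kappa q ^ 2 = scaling_K q ta N a"
    using q by (simp add: scaling_K_def lattice_c1_def qpow_of_nat)
  then show ?thesis
    unfolding scaling_C_def 1 of_real_power power_mult power_mult_distrib[symmetric] by (simp only:)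
qed

section \<open>Real form of the rescaled quantities\<close>

context
  fixes q ta tb tc \<alpha> \<beta> :: real and a b :: complex and N :: nat
  assumes q: "0 < q" "q < 1" and ta: "ta \<noteq> 0" and tb: "tb \<noteq> 0"
    and \<alpha>: "q powr \<alpha> = ta" and \<beta>: "q powr \<beta> = tb"
    and ba: "b - a = of_nat N + 1" and ab: "qpow q (a + b) = of_real (tc / ta)"
begin

lemma racah_parameters:
  "qpow q (of_real \<alpha> + of_real \<beta> + 1) = of_real (q * ta * tb)"
  "qpow q (a - b + 1) = of_real (1 / q ^ N)"
  "qpow q (of_real \<beta> + 1) = of_real (q * tb)"
  "qpow q (a + b + of_real \<alpha> + 1) = of_real (q * tc)"
  "qpow q (2 * a + 1) = of_real (tc / ta / q ^ N)"
proof -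
  note add = qpow_add[OF q(1)] and minus = qpow_minus
  have \<alpha>': "qpow q (of_real \<alpha>) = of_real ta" and \<beta>': "qpow q (of_real \<beta>) = of_real tb"
    using \<alpha> \<beta> by (simp_all only: qpow_of_real[OF q(1)])
  show "qpow q (of_real \<alpha> + of_real \<beta> + 1) = of_real (q * ta * tb)"
    unfolding add \<alpha>' \<beta>' qpow_1[OF q(1)] by simp
  show "qpow q (of_real \<beta> + 1) = of_real (q * tb)"
    unfolding add \<beta>' qpow_1[OF q(1)] by simp
  show "qpow q (a + b + of_real \<alpha> + 1) = of_real (q * tc)"
    unfolding add[of "_ + of_real \<alpha>"] add[of "a + b"] ab \<alpha>' qpow_1[OF q(1)] using ta by simp
  have "a - b + 1 = - of_nat N"
    using ba by (simp add: algebra_simps)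
  then show A1: "qpow q (a - b + 1) = of_real (1 / q ^ N)"
    by (simp add: minus qpow_of_nat[OF q(1)] divide_inverse)
  \<comment> \<open>Only the prescribed a + b and a - b occur, so q^(2a+1) is real although q^a need
    not be.\<close>
  have "2 * a + 1 = (a + b) + (a - b + 1)"
    by simp
  then show "qpow q (2 * a + 1) = of_real (tc / ta / q ^ N)"
    by (simp only: add[of "a + b"] ab A1) simp
qed

lemma scaled_beta:
  "scaling_K q ta N a * (qRacah_beta q (of_real \<alpha>) (of_real \<beta>) a b n - lattice_c3 q)
    = of_real (q ^ (N + 1) * ta * (1 + tc / ta / q ^ N
      - racah_A q (q * ta * tb) (1 / q ^ N) (q * tb) (q * tc) n
      - racah_C q (q * ta * tb) (tc / ta / q ^ N) (1 / q ^ N) (q * tb) (q * tc) n))"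
proof -
  have "scaling_K q ta N a * (qRacah_beta q (of_real \<alpha>) (of_real \<beta>) a b n - lattice_c3 q)
    = scaling_K q ta N a * (lattice_c1 q * qpow q (- a - 1)) * of_real (1 + tc / ta / q ^ N
      - racah_A q (q * ta * tb) (1 / q ^ N) (q * tb) (q * tc) n
      - racah_C q (q * ta * tb) (tc / ta / q ^ N) (1 / q ^ N) (q * tb) (q * tc) n)"
    unfolding qRacah_beta_eq[OF q] racah_parameters of_real_racah_A of_real_racah_C of_real_diff of_real_add
    by simp
  then show ?thesis
    unfolding scaling_K_mult_scale[OF q] of_real_mult .
qed

lemma scaled_gamma:
  assumes "n \<ge> 1"
  shows "(scaling_K q ta N a)\<^sup>2 * qRacah_gamma q (of_real \<alpha>) (of_real \<beta>) a b n
    = of_real ((q ^ (N + 1) * ta)\<^sup>2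
      * racah_A q (q * ta * tb) (1 / q ^ N) (q * tb) (q * tc) (n - 1)
      * racah_C q (q * ta * tb) (tc / ta / q ^ N) (1 / q ^ N) (q * tb) (q * tc) n)"
proof -
  have "(scaling_K q ta N a)\<^sup>2 * qRacah_gamma q (of_real \<alpha>) (of_real \<beta>) a b n
    = (scaling_K q ta N a * (lattice_c1 q * qpow q (- a - 1)))\<^sup>2
      * of_real (racah_A q (q * ta * tb) (1 / q ^ N) (q * tb) (q * tc) (n - 1))
      * of_real (racah_C q (q * ta * tb) (tc / ta / q ^ N) (1 / q ^ N) (q * tb) (q * tc) n)"
    unfolding qRacah_gamma_eq[OF q assms] racah_parameters of_real_racah_A of_real_racah_C power_mult_distrib
    by simp
  then show ?thesis
    unfolding scaling_K_mult_scale[OF q] of_real_mult of_real_power .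
qed

text \<open>The shift by \<open>a\<close> turns E and F into q^(-s) and q^(s+2a+1), which are real
  at the points of both families.\<close>

lemma scaled_mu:
  assumes "qpow q (- s) = of_real x" "qpow q (s + (2 * a + 1)) = of_real y"
  shows "mu_tilde q ta N a s = of_real (q ^ (N + 1) * ta * (x + y))"
proof -
  have "qpow q (s + a) = qpow q (- a - 1) * of_real y" "qpow q (- (s + a) - 1) = qpow q (- a - 1) * of_real x"
    unfolding assms[symmetric] qpow_add[OF q(1), symmetric] by (simp_all add: algebra_simps)
  then have "mu_tilde q ta N a s = scaling_K q ta N a * (lattice_c1 q * qpow q (- a - 1)) * of_real (x + y)"
    unfolding mu_tilde_eq lattice_mu_minus_c3[OF q] by (simp add: algebra_simps)
  then show ?thesis
    unfolding scaling_K_mult_scale[OF q] of_real_mult .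
qed

lemma scaled_qRacah:
  assumes "qpow q (- s) = of_real x" "qpow q (s + (2 * a + 1)) = of_real y"
  shows "scaling_C q ta N a b n * qRacah q (of_real \<alpha>) (of_real \<beta>) a b n (s + a)
    = of_real ((q ^ (N + 1) * ta) ^ n
      * (qpoch (1 / q ^ N) q n * qpoch (q * tb) q n * qpoch (q * tc) q n / qpoch (q * ta * tb * q ^ n) q n)
      * racah_sum q (q * ta * tb) (1 / q ^ N) (q * tb) (q * tc) x y n)"
proof -
  have e: "a - (s + a) = - s" "a + (s + a) + 1 = s + (2 * a + 1)"
    by simp_all
  have "scaling_C q ta N a b n * qRacah q (of_real \<alpha>) (of_real \<beta>) a b n (s + a)
    = (scaling_K q ta N a * (lattice_c1 q * qpow q (- a - 1))) ^ n
      * of_real (qpoch (1 / q ^ N) q n * qpoch (q * tb) q n * qpoch (q * tc) q n / qpoch (q * ta * tb * q ^ n) q n)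
      * of_real (racah_sum q (q * ta * tb) (1 / q ^ N) (q * tb) (q * tc) x y n)"
    unfolding scaling_C_eq[OF q ba] qRacah_eq[OF q] qRacah_lead_def[OF q] racah_parameters of_real_racah_sum
      e assms power_mult_distrib of_real_divide of_real_mult of_real_qpoch of_real_power
    by (simp only: mult_ac)
  then show ?thesis
    unfolding scaling_K_mult_scale[OF q] of_real_mult of_real_power .
qed

end

section \<open>The limit transition to the big q-Jacobi polynomials\<close>

theorem mainTheorem2:
  fixes q ta tb tc :: real
    and \<alpha> \<beta> :: "nat \<Rightarrow> real"
    and a b :: "nat \<Rightarrow> complex"
  assumes q: "0 < q" "q < 1"
    and ta: "0 < q * ta" "q * ta < 1"
    and tb: "0 < q * tb" "q * tb < 1"
    and tc: "tc < 0"
    and \<alpha>: "\<And>N. N \<ge> 1 \<Longrightarrow> q powr \<alpha> N = ta"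
    and \<beta>: "\<And>N. N \<ge> 1 \<Longrightarrow> q powr \<beta> N = tb"
    and ba: "\<And>N. N \<ge> 1 \<Longrightarrow> b N - a N = of_nat N + 1"
    and ab: "\<And>N. N \<ge> 1 \<Longrightarrow> qpow q (a N + b N) = of_real (tc / ta)"
  shows
    "let u = (\<lambda>N. qRacah q (of_real (\<alpha> N)) (of_real (\<beta> N)) (a N) (b N));
         \<beta>\<^sub>R = (\<lambda>N. qRacah_beta q (of_real (\<alpha> N)) (of_real (\<beta> N)) (a N) (b N));
         \<gamma>\<^sub>R = (\<lambda>N. qRacah_gamma q (of_real (\<alpha> N)) (of_real (\<beta> N)) (a N) (b N));
         C = (\<lambda>N. scaling_C q ta N (a N) (b N));
         K = (\<lambda>N. scaling_K q ta N (a N));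
         \<mu>' = (\<lambda>N. mu_tilde q ta N (a N));
         P = (\<lambda>n z. bigqJacobi n z ta tb tc q);
         \<beta>' = bigqJacobi_beta q ta tb tc;
         \<gamma>' = bigqJacobi_gamma q ta tb tc
     in
       \<comment> \<open>the recurrence of the q-Racah polynomials, and its rewritten form\<close>
       (\<forall>N\<ge>1. \<forall>n<N. \<forall>s.
          lattice_mu q s * u N n s =
            u N (n+1) s + \<beta>\<^sub>R N n * u N n s
            + \<gamma>\<^sub>R N n * (if n = 0 then 0 else u N (n-1) s)) \<and>
       (\<forall>N\<ge>1. \<forall>n<N. \<forall>s.
          \<mu>' N s * (C N n * u N n (s + a N)) =
            K N * (C N n * u N (n+1) (s + a N))
            + K N * (\<beta>\<^sub>R N n - lattice_c3 q) * (C N n * u N n (s + a N))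
            + K N * \<gamma>\<^sub>R N n * (C N n * (if n = 0 then 0 else u N (n-1) (s + a N)))) \<and>
       \<comment> \<open>its termwise limit, along s = k (z = q^(k+1) tc) and along s = N - k (z = q^(k+1) ta)\<close>
       (\<forall>k. \<forall>(s, z) \<in> {(\<lambda>N. of_nat k, q^(k+1) * tc), (\<lambda>N. of_nat N - of_nat k, q^(k+1) * ta)}.
          (\<lambda>N. \<mu>' N (s N)) \<longlonglongrightarrow> of_real z \<and>
          (\<forall>n.
            (\<lambda>N. C N n * u N n (s N + a N)) \<longlonglongrightarrow> of_real (P n z) \<and>
            (\<lambda>N. \<mu>' N (s N) * (C N n * u N n (s N + a N))) \<longlonglongrightarrow> of_real (z * P n z) \<and>
            (\<lambda>N. K N * (C N n * u N (n+1) (s N + a N))) \<longlonglongrightarrow> of_real (P (n+1) z) \<and>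
            (\<lambda>N. K N * (\<beta>\<^sub>R N n - lattice_c3 q) * (C N n * u N n (s N + a N)))
               \<longlonglongrightarrow> of_real (\<beta>' n * P n z) \<and>
            (\<lambda>N. K N * \<gamma>\<^sub>R N n * (C N n * (if n = 0 then 0 else u N (n-1) (s N + a N))))
               \<longlonglongrightarrow> of_real (\<gamma>' n * (if n = 0 then 0 else P (n-1) z)))) \<and>
       \<comment> \<open>the recurrence of the big q-Jacobi polynomials\<close>
       (\<forall>z \<in> range (\<lambda>k::nat. q^(k+1) * tc) \<union> range (\<lambda>k::nat. q^(k+1) * ta). \<forall>n.
          z * P n z = P (n+1) z + \<beta>' n * P n z + \<gamma>' n * (if n = 0 then 0 else P (n-1) z)) \<and>
       \<comment> \<open>the limits of the coefficients\<close>
       (\<forall>n. (\<lambda>N. K N * (\<beta>\<^sub>R N n - lattice_c3 q)) \<longlonglongrightarrow> of_real (\<beta>' n)) \<and>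
       (\<forall>n\<ge>1. (\<lambda>N. K N * (C N n / C N (n-1)) * \<gamma>\<^sub>R N n) \<longlonglongrightarrow> of_real (\<gamma>' n)) \<and>
       (\<forall>n. \<beta>' n = bigqJacobi_beta_alt q ta tb tc n)"
proof -
  define u where "u N = qRacah q (of_real (\<alpha> N)) (of_real (\<beta> N)) (a N) (b N)" for N
  define \<beta>R where "\<beta>R N = qRacah_beta q (of_real (\<alpha> N)) (of_real (\<beta> N)) (a N) (b N)" for N
  define \<gamma>R where "\<gamma>R N = qRacah_gamma q (of_real (\<alpha> N)) (of_real (\<beta> N)) (a N) (b N)" for N
  define C where "C N = scaling_C q ta N (a N) (b N)" for N
  define K where "K N = scaling_K q ta N (a N)" for N
  define \<mu>' where "\<mu>' N = mu_tilde q ta N (a N)" for N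
  define P where "P n z = bigqJacobi n z ta tb tc q" for n z
  define \<beta>' where "\<beta>' = bigqJacobi_beta q ta tb tc"
  define \<gamma>' where "\<gamma>' = bigqJacobi_gamma q ta tb tc"

  have pos: "0 < ta" "0 < tb"
    using q ta tb by (auto simp: zero_less_mult_iff)
  have nz: "ta \<noteq> 0" "tb \<noteq> 0" "tc \<noteq> 0"
    using pos tc by auto
  \<comment> \<open>Negative x are included for the sake of q tc.\<close>
  have small: "x * q ^ j \<noteq> 1" if "x < 1" for x :: real and j
  proof (cases "0 < x")
    case True
    have "x * q ^ j \<le> x * 1"
      using True q by (intro mult_left_mono power_le_one) auto
    then show ?thesis using that by simp
  next
    case False
    then have "x * q ^ j \<le> 0"
      using q by (simp add: mult_nonpos_nonneg)
    then show ?thesis by simp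
  qed
  \<comment> \<open>For i >= 1 the number is (q ta) (q tb) q^(i-1), a product with factors at most
    1, the first two below 1. For i = 0 the value 1 is possible.\<close>
  have rho_small: "q * ta * tb * q ^ i \<noteq> 1" if "i \<ge> 1" for i
  proof -
    obtain m where m: "i = Suc m"
      using \<open>i \<ge> 1\<close> by (cases i) auto
    have "(q * ta) * (q * tb) < 1 * 1"
      using ta tb by (intro mult_strict_mono) auto
    then have "(q * ta) * (q * tb) * q ^ m \<noteq> 1"
      by (intro small) simp
    then show ?thesis
      by (simp add: m mult_ac)
  qed
  have alt: "\<beta>' n = bigqJacobi_beta_alt q ta tb tc n" for n
    unfolding \<beta>'_def
  proof (rule bigqJacobi_beta_eq_alt)
    show "ta * tb * q ^ i \<noteq> 1" if "i \<ge> 2" for i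
      using rho_small[of "i - 1"] that by (cases i) (auto simp: mult_ac)
  qed (rule nz)

  have params: "qpow q (of_real (\<alpha> N) + of_real (\<beta> N) + 1) = of_real (q * ta * tb)"
    "qpow q (a N - b N + 1) = of_real (1 / q ^ N)"
    "qpow q (of_real (\<beta> N) + 1) = of_real (q * tb)"
    "qpow q (a N + b N + of_real (\<alpha> N) + 1) = of_real (q * tc)"
    "qpow q (2 * a N + 1) = of_real (tc / ta / q ^ N)" if "N \<ge> 1" for N
    using racah_parameters[OF q nz(1,2) \<alpha>[OF that] \<beta>[OF that] ba[OF that] ab[OF that]] .
  have K0: "K N \<noteq> 0" for N
    unfolding K_def by (rule scaling_K_neq_0[OF q nz(1)])
  have CK: "C N n = K N ^ n" if "N \<ge> 1" for N n
    unfolding C_def K_def by (rule scaling_C_eq[OF q ba[OF that]])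

  have rec: "lattice_mu q s * u N n s = u N (n+1) s + \<beta>R N n * u N n s
      + \<gamma>R N n * (if n = 0 then 0 else u N (n-1) s)" if N: "N \<ge> 1" "n < N" for N n s
  proof -
    have real: "of_real x * of_real q ^ i \<noteq> (1 :: complex)" if "x * q ^ i \<noteq> 1" for x i
      using that by (metis of_real_eq_1_iff of_real_mult of_real_power)
    show ?thesis
      unfolding u_def \<beta>R_def \<gamma>R_def
    proof (rule qRacah_recurrence[OF q], unfold params[OF N(1)])
      show "of_real (q * ta * tb) * of_real q ^ i \<noteq> (1 :: complex)" if "i \<ge> 1" for i
        by (rule real) (rule rho_small[OF that])
      show "of_real (1 / q ^ N) * of_real q ^ j \<noteq> (1 :: complex)" if "j \<le> n" for j
      proof (rule real)
        \<comment> \<open>This is where n < N enters.\<close>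
        have "q ^ N < q ^ j"
          using q N that by (intro power_strict_decreasing) auto
        then have "1 < q ^ j / q ^ N"
          using q by (simp only: less_divide_eq_1_pos zero_less_power)
        then show "1 / q ^ N * q ^ j \<noteq> 1"
          unfolding times_divide_eq_left mult_1 by linarith
      qed
      show "of_real (q * tb) * of_real q ^ j \<noteq> (1 :: complex)" for j
        by (rule real) (rule small[OF tb(2)])
      have "q * tc < 1"
        using mult_pos_neg[OF q(1) tc] by simp
      then show "of_real (q * tc) * of_real q ^ j \<noteq> (1 :: complex)" for j
        by (intro real small)
    qed
  qed
  have rec': "\<mu>' N s * (C N n * u N n (s + a N)) =
            K N * (C N n * u N (n+1) (s + a N))
            + K N * (\<beta>R N n - lattice_c3 q) * (C N n * u N n (s + a N))
            + K N * \<gamma>R N n * (C N n * (if n = 0 then 0 else u N (n-1) (s + a N)))"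
    if N: "N \<ge> 1" "n < N" for N n s
  proof -
    have "\<mu>' N s * (C N n * u N n (s + a N))
        = K N * C N n * (lattice_mu q (s + a N) * u N n (s + a N)) - K N * C N n * lattice_c3 q * u N n (s + a N)"
      unfolding \<mu>'_def mu_tilde_eq K_def by (simp add: algebra_simps)
    then show ?thesis
      unfolding rec[OF N] by (simp add: algebra_simps)
  qed

  have lim_\<beta>: "(\<lambda>N. K N * (\<beta>R N n - lattice_c3 q)) \<longlonglongrightarrow> of_real (\<beta>' n)" for n
  proof (rule Lim_transform_eventually)
    show "(\<lambda>N. complex_of_real (q ^ (N + 1) * ta * (1 + tc / ta / q ^ N
      - racah_A q (q * ta * tb) (1 / q ^ N) (q * tb) (q * tc) n
      - racah_C q (q * ta * tb) (tc / ta / q ^ N) (1 / q ^ N) (q * tb) (q * tc) n))) \<longlonglongrightarrow> of_real (\<beta>' n)"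
      unfolding alt by (intro tendsto_of_real tendsto_racah_beta q nz)
    show "\<forall>\<^sub>F N in sequentially. complex_of_real (q ^ (N + 1) * ta * (1 + tc / ta / q ^ N
      - racah_A q (q * ta * tb) (1 / q ^ N) (q * tb) (q * tc) n
      - racah_C q (q * ta * tb) (tc / ta / q ^ N) (1 / q ^ N) (q * tb) (q * tc) n))
      = K N * (\<beta>R N n - lattice_c3 q)"
      using eventually_ge_at_top[of 1]
    proof eventually_elim
      case (elim N)
      show ?case
        unfolding K_def \<beta>R_def
        by (rule scaled_beta[OF q nz(1,2) \<alpha>[OF elim] \<beta>[OF elim] ba[OF elim] ab[OF elim], symmetric])
    qed
  qed
  have lim_\<gamma>: "(\<lambda>N. (K N)\<^sup>2 * \<gamma>R N n) \<longlonglongrightarrow> of_real (\<gamma>' n)" if n: "n \<ge> 1" for n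
  proof (rule Lim_transform_eventually)
    obtain m where m: "n = Suc m"
      using n by (cases n) auto
    show "(\<lambda>N. complex_of_real ((q ^ (N + 1) * ta)\<^sup>2
      * racah_A q (q * ta * tb) (1 / q ^ N) (q * tb) (q * tc) (n - 1)
      * racah_C q (q * ta * tb) (tc / ta / q ^ N) (1 / q ^ N) (q * tb) (q * tc) n)) \<longlonglongrightarrow> of_real (\<gamma>' n)"
      unfolding \<gamma>'_def m diff_Suc_1 by (intro tendsto_of_real tendsto_racah_gamma q nz)
    show "\<forall>\<^sub>F N in sequentially. complex_of_real ((q ^ (N + 1) * ta)\<^sup>2
      * racah_A q (q * ta * tb) (1 / q ^ N) (q * tb) (q * tc) (n - 1)
      * racah_C q (q * ta * tb) (tc / ta / q ^ N) (1 / q ^ N) (q * tb) (q * tc) n)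
      = (K N)\<^sup>2 * \<gamma>R N n"
      using eventually_ge_at_top[of 1]
    proof eventually_elim
      case (elim N)
      show ?case
        unfolding K_def \<gamma>R_def
        by (rule scaled_gamma[OF q nz(1,2) \<alpha>[OF elim] \<beta>[OF elim] ba[OF elim] ab[OF elim] n, symmetric])
    qed
  qed
  have lim_\<gamma>': "(\<lambda>N. K N * (C N n / C N (n - 1)) * \<gamma>R N n) \<longlonglongrightarrow> of_real (\<gamma>' n)" if n: "n \<ge> 1" for n
  proof (rule Lim_transform_eventually[OF lim_\<gamma>[OF n]])
    show "\<forall>\<^sub>F N in sequentially. (K N)\<^sup>2 * \<gamma>R N n = K N * (C N n / C N (n - 1)) * \<gamma>R N n"
      using eventually_ge_at_top[of 1]
    proof eventually_elim
      case (elim N)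
      \<comment> \<open>Thus C_n / C_(n-1) is K, and the coefficient is K^2 \<gamma>_n.\<close>
      have "C N n = K N * C N (n - 1)"
        using n by (cases n) (auto simp: CK[OF elim])
      then show ?case
        using K0[of N] by (simp add: CK[OF elim] power2_eq_square)
    qed
  qed

  \<comment> \<open>Both families of points at once: one of q^(-s), q^(s+2a+1) is a constant e, the
    other is w / q^N, and their order is left open.\<close>
  have limits: "(\<lambda>N. \<mu>' N (s N)) \<longlonglongrightarrow> of_real (q * ta * w)"
    "(\<lambda>N. C N n * u N n (s N + a N)) \<longlonglongrightarrow> of_real (P n (q * ta * w))"
    "(\<lambda>N. K N * (C N n * u N (n+1) (s N + a N))) \<longlonglongrightarrow> of_real (P (n+1) (q * ta * w))"
    "(\<lambda>N. K N * \<gamma>R N n * (C N n * (if n = 0 then 0 else u N (n-1) (s N + a N))))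
         \<longlonglongrightarrow> of_real (\<gamma>' n * (if n = 0 then 0 else P (n-1) (q * ta * w)))"
    if ew: "e * w = tc / ta"
      and s: "\<And>N. N \<ge> 1 \<Longrightarrow>
        qpow q (- s N) = of_real e \<and> qpow q (s N + (2 * a N + 1)) = of_real (w / q ^ N) \<or>
        qpow q (- s N) = of_real (w / q ^ N) \<and> qpow q (s N + (2 * a N + 1)) = of_real e"
    for s :: "nat \<Rightarrow> complex" and e w :: real and n
  proof -
    have w: "w \<noteq> 0" using ew nz by auto
    show "(\<lambda>N. \<mu>' N (s N)) \<longlonglongrightarrow> of_real (q * ta * w)"
    proof (rule Lim_transform_eventually)
      have "(\<lambda>N. complex_of_real (q * ta * e * q ^ N + q * ta * w)) \<longlonglongrightarrow> of_real (q * ta * e * 0 + q * ta * w)"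
        using q by (intro tendsto_of_real tendsto_add tendsto_mult tendsto_const LIMSEQ_power_zero) auto
      then show "(\<lambda>N. complex_of_real (q * ta * e * q ^ N + q * ta * w)) \<longlonglongrightarrow> of_real (q * ta * w)"
        by simp
      show "\<forall>\<^sub>F N in sequentially. complex_of_real (q * ta * e * q ^ N + q * ta * w) = \<mu>' N (s N)"
        using eventually_ge_at_top[of 1]
      proof eventually_elim
        case (elim N)
        note scaled = scaled_mu[OF q nz(1,2) \<alpha>[OF elim] \<beta>[OF elim] ba[OF elim] ab[OF elim]]
        have "\<mu>' N (s N) = of_real (q ^ (N + 1) * ta * (e + w / q ^ N))"
          using s[OF elim] scaled[of "s N" e "w / q ^ N"] scaled[of "s N" "w / q ^ N" e]
          unfolding \<mu>'_def add.commute[of "w / q ^ N"] by blast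
        also have "q ^ (N + 1) * ta * (e + w / q ^ N) = q * ta * e * q ^ N + q * ta * w"
          using q by (simp add: field_simps)
        finally show ?case ..
      qed
    qed
    have lim_u: "(\<lambda>N. C N n * u N n (s N + a N)) \<longlonglongrightarrow> of_real (P n (q * ta * w))" for n
    proof (rule Lim_transform_eventually)
      let ?p = "\<lambda>N. (q ^ (N + 1) * ta) ^ n
          * (qpoch (1 / q ^ N) q n * qpoch (q * tb) q n * qpoch (q * tc) q n / qpoch (q * ta * tb * q ^ n) q n)
          * racah_sum q (q * ta * tb) (1 / q ^ N) (q * tb) (q * tc) e (w / q ^ N) n"
      show "(\<lambda>N. complex_of_real (?p N)) \<longlonglongrightarrow> of_real (P n (q * ta * w))"
        unfolding P_def by (intro tendsto_of_real tendsto_racah_bigqJacobi q nz w ew)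
      show "\<forall>\<^sub>F N in sequentially. complex_of_real (?p N) = C N n * u N n (s N + a N)"
        using eventually_ge_at_top[of 1]
      proof eventually_elim
        case (elim N)
        note scaled = scaled_qRacah[OF q nz(1,2) \<alpha>[OF elim] \<beta>[OF elim] ba[OF elim] ab[OF elim]]
        from s[OF elim] show ?case
        proof
          assume "qpow q (- s N) = of_real e \<and> qpow q (s N + (2 * a N + 1)) = of_real (w / q ^ N)"
          then show ?thesis
            unfolding C_def u_def by (intro scaled[symmetric]) auto
        next
          assume "qpow q (- s N) = of_real (w / q ^ N) \<and> qpow q (s N + (2 * a N + 1)) = of_real e"
          then show ?thesis
            unfolding C_def u_def racah_sum_commute[of _ _ _ _ _ e] by (intro scaled[symmetric]) auto
        qed
      qed
    qed
    then show "(\<lambda>N. C N n * u N n (s N + a N)) \<longlonglongrightarrow> of_real (P n (q * ta * w))" .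
    show "(\<lambda>N. K N * (C N n * u N (n+1) (s N + a N))) \<longlonglongrightarrow> of_real (P (n+1) (q * ta * w))"
    \<comment> \<open>K C_n = C_(n+1), so this is the preceding limit at n + 1.\<close>
    proof (rule Lim_transform_eventually[OF lim_u])
      show "\<forall>\<^sub>F N in sequentially. C N (n + 1) * u N (n + 1) (s N + a N) = K N * (C N n * u N (n + 1) (s N + a N))"
        using eventually_ge_at_top[of 1] by eventually_elim (simp add: CK)
    qed
    show "(\<lambda>N. K N * \<gamma>R N n * (C N n * (if n = 0 then 0 else u N (n-1) (s N + a N))))
         \<longlonglongrightarrow> of_real (\<gamma>' n * (if n = 0 then 0 else P (n-1) (q * ta * w)))"
    proof (cases n)
      case (Suc m)
      \<comment> \<open>C_n = K C_(n-1) supplies the second factor K that \<gamma>_n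
        requires.\<close>
      have "(\<lambda>N. (K N)\<^sup>2 * \<gamma>R N n * (C N m * u N m (s N + a N))) \<longlonglongrightarrow> of_real (\<gamma>' n) * of_real (P m (q * ta * w))"
        by (intro tendsto_mult lim_\<gamma> lim_u) (simp add: Suc)
      then have "(\<lambda>N. K N * \<gamma>R N n * (C N n * u N m (s N + a N))) \<longlonglongrightarrow> of_real (\<gamma>' n) * of_real (P m (q * ta * w))"
      proof (rule Lim_transform_eventually)
        show "\<forall>\<^sub>F N in sequentially. (K N)\<^sup>2 * \<gamma>R N n * (C N m * u N m (s N + a N))
            = K N * \<gamma>R N n * (C N n * u N m (s N + a N))"
          using eventually_ge_at_top[of 1]
          by eventually_elim (simp add: CK Suc power2_eq_square)
      qed
      then show ?thesis
        by (simp add: Suc)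
    qed simp
  qed
  have limits': "(\<lambda>N. \<mu>' N (s N)) \<longlonglongrightarrow> of_real z \<and>
      (\<forall>n.
        (\<lambda>N. C N n * u N n (s N + a N)) \<longlonglongrightarrow> of_real (P n z) \<and>
        (\<lambda>N. \<mu>' N (s N) * (C N n * u N n (s N + a N))) \<longlonglongrightarrow> of_real (z * P n z) \<and>
        (\<lambda>N. K N * (C N n * u N (n+1) (s N + a N))) \<longlonglongrightarrow> of_real (P (n+1) z) \<and>
        (\<lambda>N. K N * (\<beta>R N n - lattice_c3 q) * (C N n * u N n (s N + a N)))
           \<longlonglongrightarrow> of_real (\<beta>' n * P n z) \<and>
        (\<lambda>N. K N * \<gamma>R N n * (C N n * (if n = 0 then 0 else u N (n-1) (s N + a N))))
           \<longlonglongrightarrow> of_real (\<gamma>' n * (if n = 0 then 0 else P (n-1) z)))"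
    if sz: "(s, z) \<in> {(\<lambda>N. of_nat k, q^(k+1) * tc), (\<lambda>N. of_nat N - of_nat k, q^(k+1) * ta)}" for s z k
  proof -
    obtain e w where ew: "e * w = tc / ta" and z: "z = q * ta * w"
      and s: "\<And>N. N \<ge> 1 \<Longrightarrow>
        qpow q (- s N) = of_real e \<and> qpow q (s N + (2 * a N + 1)) = of_real (w / q ^ N) \<or>
        qpow q (- s N) = of_real (w / q ^ N) \<and> qpow q (s N + (2 * a N + 1)) = of_real e"
    proof -
      from sz consider "s = (\<lambda>N. of_nat k)" "z = q^(k+1) * tc" | "s = (\<lambda>N. of_nat N - of_nat k)" "z = q^(k+1) * ta"
        by auto
      then show thesis
      proof cases
        case 1
        show thesis
        \<comment> \<open>Here q^(-s) = q^(-k) is the constant, and w is q^N q^(s+2a+1).\<close>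
        proof (rule that[of "1 / q ^ k" "q ^ k * (tc / ta)"])
          show "1 / q ^ k * (q ^ k * (tc / ta)) = tc / ta" using q by simp
          show "z = q * ta * (q ^ k * (tc / ta))" using 1 nz by simp
          show "qpow q (- s N) = of_real (1 / q ^ k) \<and> qpow q (s N + (2 * a N + 1)) = of_real (q ^ k * (tc / ta) / q ^ N) \<or>
            qpow q (- s N) = of_real (q ^ k * (tc / ta) / q ^ N) \<and> qpow q (s N + (2 * a N + 1)) = of_real (1 / q ^ k)"
            if "N \<ge> 1" for N
            unfolding 1 qpow_minus qpow_add[OF q(1), of "of_nat k"] qpow_of_nat[OF q(1)] params(5)[OF that]
            by (simp add: divide_inverse)
        qed
      next
        case 2
        show thesis
        \<comment> \<open>Now q^(-s) = q^k / q^N yields w, and q^(s+2a+1) is the constant.\<close>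
        proof (rule that[of "tc / ta / q ^ k" "q ^ k"])
          show "tc / ta / q ^ k * q ^ k = tc / ta" using q by simp
          show "z = q * ta * q ^ k" using 2 by simp
          show "qpow q (- s N) = of_real (tc / ta / q ^ k) \<and> qpow q (s N + (2 * a N + 1)) = of_real (q ^ k / q ^ N) \<or>
            qpow q (- s N) = of_real (q ^ k / q ^ N) \<and> qpow q (s N + (2 * a N + 1)) = of_real (tc / ta / q ^ k)"
            if "N \<ge> 1" for N
            unfolding 2 qpow_minus qpow_add[OF q(1), of "of_nat N - of_nat k"] qpow_diff[OF q(1), of "of_nat N"]
              qpow_of_nat[OF q(1)] params(5)[OF that]
            using q by simp
        qed
      qed
    qed
    note lim = limits[OF ew s, folded z]
    show ?thesis
      unfolding of_real_mult[of z] of_real_mult[of "\<beta>' _"]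
      by (intro conjI allI tendsto_mult lim lim_\<beta>)
  qed

  have jacobi: "z * P n z = P (n+1) z + \<beta>' n * P n z + \<gamma>' n * (if n = 0 then 0 else P (n-1) z)"
    if "z \<in> range (\<lambda>k::nat. q^(k+1) * tc) \<union> range (\<lambda>k::nat. q^(k+1) * ta)" for z n
  proof -
    obtain s :: "nat \<Rightarrow> complex" and k
      where "(s, z) \<in> {(\<lambda>N. of_nat k, q^(k+1) * tc), (\<lambda>N. of_nat N - of_nat k, q^(k+1) * ta)}"
      using \<open>z \<in> _\<close> by blast
    note lim = limits'[OF this, THEN conjunct2, rule_format, of n]
    \<comment> \<open>For N > n the rescaled recurrence holds, so its left side converges to the sum
      of the limits on the right; uniqueness of limits gives the claim.\<close>
    have "(\<lambda>N. \<mu>' N (s N) * (C N n * u N n (s N + a N)))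
      \<longlonglongrightarrow> of_real (P (n+1) z) + of_real (\<beta>' n * P n z) + of_real (\<gamma>' n * (if n = 0 then 0 else P (n-1) z))"
    proof (rule Lim_transform_eventually)
      show "(\<lambda>N. K N * (C N n * u N (n+1) (s N + a N))
            + K N * (\<beta>R N n - lattice_c3 q) * (C N n * u N n (s N + a N))
            + K N * \<gamma>R N n * (C N n * (if n = 0 then 0 else u N (n-1) (s N + a N))))
        \<longlonglongrightarrow> of_real (P (n+1) z) + of_real (\<beta>' n * P n z) + of_real (\<gamma>' n * (if n = 0 then 0 else P (n-1) z))"
        using lim by (intro tendsto_add) blast+
      show "\<forall>\<^sub>F N in sequentially. K N * (C N n * u N (n+1) (s N + a N))
            + K N * (\<beta>R N n - lattice_c3 q) * (C N n * u N n (s N + a N))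
            + K N * \<gamma>R N n * (C N n * (if n = 0 then 0 else u N (n-1) (s N + a N)))
          = \<mu>' N (s N) * (C N n * u N n (s N + a N))"
        using eventually_gt_at_top[of n]
        by eventually_elim (rule rec'[symmetric], auto)
    qed
    moreover have "(\<lambda>N. \<mu>' N (s N) * (C N n * u N n (s N + a N))) \<longlonglongrightarrow> of_real (z * P n z)"
      using lim by blast
    ultimately have "complex_of_real (z * P n z)
      = of_real (P (n+1) z) + of_real (\<beta>' n * P n z) + of_real (\<gamma>' n * (if n = 0 then 0 else P (n-1) z))"
      by (intro LIMSEQ_unique)
    then show ?thesis
      unfolding of_real_add[symmetric] of_real_eq_iff .
  qed

  show ?thesis
    unfolding Let_def u_def[symmetric] \<beta>R_def[symmetric] \<gamma>R_def[symmetric] C_def[symmetric] K_def[symmetric]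
      \<mu>'_def[symmetric] P_def[symmetric] \<beta>'_def[symmetric] \<gamma>'_def[symmetric]
  proof (intro conjI, goal_cases)
    case 1
    show ?case by (intro allI impI rec)
  next
    case 2
    show ?case by (intro allI impI rec')
  next
    case 3
    show ?case
      by (intro allI ballI) (simp only: split_paired_all case_prod_conv, rule limits')
  next
    case 4
    show ?case by (intro ballI allI jacobi)
  next
    case 5
    show ?case by (intro allI lim_\<beta>)
  next
    case 6
    show ?case by (intro allI impI lim_\<gamma>')
  next
    case 7
    show ?case by (intro allI alt)
  qed
qed

end
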